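(* Let $p<q$ be square-free integers $\ge 2$ with $p\equiv 2\pmod 4$ and $q\equiv 3\pmod 4$, put $r=pq/\gcd(p,q)^2$ and assume $p<q<r$. Let $K=\mathbb{Q}(\sqrt p,\sqrt q)$, $F_1=\mathbb{Q}(\sqrt p)$, $F_2=\mathbb{Q}(\sqrt q)$. Let $m$ be a positive integer such that, for some positive integer $\kappa$, $m\le \min\{\frac{r}{4\lceil \kappa\sqrt r\rceil},\,p,\,q\}$. If $p\ge(\frac m2+4)^2$ and $q\geq \left(\frac m2+4\right)^2$, then not all elements of $m\mathcal{O}_{F_1}^+$ are sums of squares of elements of $\mathcal{O}_K$, and not all elements of $m\mathcal{O}_{F_2}^+$ are sums of squares of elements of $\mathcal{O}_K$.
   Context: For a totally real number field $F$, $\mathcal{O}_F$ is its ring of integers, $\mathcal{O}_F^+$ is the set of totally positive elements of $\mathcal{O}_F$ (all real embeddings positive), and $m\mathcal{O}_F^+=\{m\alpha:\alpha\in\mathcal{O}_F^+\}$. A sum of squares in $\mathcal{O}_K$ is a finite sum $\sum_i\alpha_i^2$ with $\alpha_i\in\mathcal{O}_K$ (any number of summands). *)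

theory Defs
  imports
    "HOL-Computational_Algebra.Squarefree"
    "HOL-Algebra.Generated_Fields"
    "HOL-Algebra.Algebraic_Closure_Type"
begin

abbreviation real_field :: "real ring" where
  "real_field \<equiv> ring_of_type_algebra"

text \<open>A totally real number field is represented as a subfield of the real numbers.
  Generated subfields contain 1, hence the rational numbers.\<close>

definition rat_adjoin :: "real set \<Rightarrow> real set" where
  "rat_adjoin S = generate_field real_field S"

definition ring_of_integers :: "real set \<Rightarrow> real set" where
  "ring_of_integers F = {x \<in> F. algebraic_int x}"

text \<open>Members of \<^const>\<open>ring_hom\<close> are only constrained on the carrier of the domain, so each
  real embedding of \<open>F\<close> occurs with all its extensions to functions on the reals.\<close>

definition real_embeddings :: "real set \<Rightarrow> (real \<Rightarrow> real) set" where
  "real_embeddings F = ring_hom (real_field\<lparr>carrier := F\<rparr>) real_field"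

definition totally_positive_integers :: "real set \<Rightarrow> real set" where
  "totally_positive_integers F =
     {\<alpha> \<in> ring_of_integers F. \<forall>\<sigma> \<in> real_embeddings F. 0 < \<sigma> \<alpha>}"

definition sums_of_squares :: "real set \<Rightarrow> real set" where
  "sums_of_squares A = {x. \<exists>xs. set xs \<subseteq> A \<and> x = (\<Sum>a\<leftarrow>xs. a\<^sup>2)}"

end

theory Submission
  imports Defs
begin

text \<open>
  Inside \<open>\<int>[\<surd>D]\<close> with \<open>\<surd>D \<ge> m/2 + 4\<close>, some \<open>m\<alpha>\<close> with \<open>\<alpha>\<close> totally positive is not a sum of squares.
  For odd \<open>m\<close> this is a parity obstruction. For \<open>m = 2s\<close> put \<open>c = \<surd>D - s\<close>,
  \<open>v = \<lceil>2s/c\<^sup>2\<rceil>\<close> and \<open>\<alpha> = \<lceil>v\<surd>D\<rceil> + v\<surd>D\<close>: if \<open>m\<alpha> = \<Sum>(a\<^sub>i + b\<^sub>i\<surd>D)\<^sup>2\<close>, then by Cauchy-Schwarz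
  \<open>n = \<Sum>b\<^sub>i\<^sup>2\<close> satisfies \<open>(n\<surd>D - sv)\<^sup>2 < 2sn\<close>, which is impossible both for \<open>n \<ge> v\<close> and for
  \<open>n < v\<close>. Choosing \<open>\<alpha>\<close> with minimal rational part makes it indecomposable, that is, not a sum of two
  totally positive elements.

  Write \<open>p = gp'\<close>, \<open>q = gq'\<close>, \<open>r = p'q'\<close>. An integer of \<open>K\<close> is
  \<open>a + b\<surd>p/2 + c\<surd>q + d\<surd>r/2\<close> with \<open>b \<equiv> d\<close> modulo 2. If \<open>m\<alpha>\<close> with \<open>\<alpha> \<in> \<int>[\<surd>p]\<close> is a sum of squares of such
  elements, averaging over \<open>\<surd>q \<mapsto> -\<surd>q\<close> splits off the terms
  \<open>(c\<surd>q + d\<surd>r/2)\<^sup>2 = (q'/4) (4gc\<^sup>2 + p'd\<^sup>2 + 4cd\<surd>p)\<close>. As \<open>q' > 4m\<close>, a nonzero such term gives a totally positive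
  \<open>\<beta> \<in> \<int>[\<surd>p]\<close> with \<open>\<alpha> - \<beta>\<close> totally positive, contrary to indecomposability; hence all summands lie
  in \<open>\<int>[\<surd>p]\<close>. The argument for \<open>\<int>[\<surd>q]\<close> is the same if \<open>p' > 2m\<close>. Otherwise \<open>\<surd>q \<ge> m + 8\<close>, and
  already the size of \<open>\<alpha> = \<lceil>\<surd>q\<rceil> + \<surd>q\<close> forces \<open>c = d = 0\<close> in every summand of \<open>m\<alpha>\<close>,
  so that the coefficient of \<open>\<surd>q\<close> in the sum vanishes instead of being \<open>m\<close>.
\<close>

section \<open>Integrality over the rationals\<close>

lemma sqrt_nat_irrational:
  assumes "n mod 4 = 2 \<or> n mod 4 = 3"
  shows "sqrt (real n) \<notin> \<rat>"
proof
  assume "sqrt (real n) \<in> \<rat>"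
  then have "sqrt (real n) \<in> \<int>"
    by (intro rational_algebraic_int_is_int algebraic_int_sqrt) auto
  then obtain k where "sqrt (real n) = of_int k"
    by (auto elim: Ints_cases)
  then have "real_of_int (int n) = of_int (k\<^sup>2)"
    by (metis of_int_of_nat_eq of_int_power of_nat_0_le_iff real_sqrt_pow2)
  then have *: "int n = k\<^sup>2"
    using of_int_eq_iff by blast
  have "int n mod 4 = 2 \<or> int n mod 4 = 3"
    using assms by (metis of_nat_mod of_nat_numeral)
  moreover have "k\<^sup>2 mod 4 = 0 \<or> k\<^sup>2 mod 4 = 1"
  proof (cases "even k")
    case True
    then obtain j where "k = 2 * j" by blast
    then show ?thesis by (simp add: power2_eq_square)
  next
    case False
    then obtain j where "k = 2 * j + 1" by (elim oddE)
    then have "k\<^sup>2 = 4 * (j * j + j) + 1" by (simp add: power2_eq_square algebra_simps)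
    then show ?thesis by presburger
  qed
  ultimately show False using * by auto
qed

lemma squarefree_mult_square_Ints:
  fixes B :: real
  assumes "squarefree D" "B \<in> \<rat>" "real D * B\<^sup>2 \<in> \<int>"
  shows "B \<in> \<int>"
proof -
  obtain a b where ab: "b > 0" "coprime a b" "B = of_int a / of_int b"
    using assms(2) by (elim Rats_cases')
  obtain k where k: "real D * B\<^sup>2 = of_int k"
    using assms(3) by (auto elim: Ints_cases)
  have "real_of_int (int D * a\<^sup>2) = of_int (k * b\<^sup>2)"
    using k ab by (simp add: field_simps power2_eq_square)
  then have "int D * a\<^sup>2 = k * b\<^sup>2"
    using of_int_eq_iff by blast
  then have "b\<^sup>2 dvd int D * a\<^sup>2" by simp
  moreover have "coprime (b\<^sup>2) (a\<^sup>2)"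
    using ab(2) by (simp add: coprime_commute)
  ultimately have "b\<^sup>2 dvd int D"
    using coprime_dvd_mult_left_iff by blast
  then have "int ((nat b)\<^sup>2) dvd int D"
    using ab(1) by simp
  then have "(nat b)\<^sup>2 dvd D"
    by (simp only: int_dvd_int_iff)
  then have "nat b dvd 1"
    using assms(1) squarefreeD by blast
  then have "b = 1" using ab(1) by simp
  then show ?thesis using ab(3) by simp
qed

lemma quadratic_integer_coeffs:
  fixes A B :: real
  assumes "squarefree D" "D mod 4 = 2 \<or> D mod 4 = 3"
    and rat: "A \<in> \<rat>" "B \<in> \<rat>"
    and int: "2 * A \<in> \<int>" "A\<^sup>2 - real D * B\<^sup>2 \<in> \<int>"
  shows "A \<in> \<int> \<and> B \<in> \<int>"
proof -
  have "real D * (2 * B)\<^sup>2 = (2 * A)\<^sup>2 - 4 * (A\<^sup>2 - real D * B\<^sup>2)"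
    by (simp add: power_mult_distrib)
  also have "\<dots> \<in> \<int>" by (rule Ints_diff[OF Ints_power[OF int(1)] Ints_mult[OF _ int(2)]]) simp
  finally have "real D * (2 * B)\<^sup>2 \<in> \<int>" .
  then have "2 * B \<in> \<int>"
    by (rule squarefree_mult_square_Ints[OF assms(1) Rats_mult[OF Rats_number_of rat(2)]])
  then obtain y where y: "2 * B = of_int y" by (auto elim: Ints_cases)
  obtain x where x: "2 * A = of_int x" using int(1) by (auto elim: Ints_cases)
  obtain n where n: "A\<^sup>2 - real D * B\<^sup>2 = of_int n" using int(2) by (auto elim: Ints_cases)
  have "real_of_int (x\<^sup>2 - int D * y\<^sup>2) = (2 * A)\<^sup>2 - real D * (2 * B)\<^sup>2"
    unfolding x y by simp
  also have "\<dots> = 4 * (A\<^sup>2 - real D * B\<^sup>2)"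
    by (simp add: power_mult_distrib)
  finally have "real_of_int (x\<^sup>2 - int D * y\<^sup>2) = of_int (4 * n)"
    unfolding n by simp
  then have eq: "x\<^sup>2 - int D * y\<^sup>2 = 4 * n"
    using of_int_eq_iff by blast
  obtain e where e: "int D = 4 * e + 2 \<or> int D = 4 * e + 3"
  proof -
    have "int D mod 4 = 2 \<or> int D mod 4 = 3"
      using assms(2) by presburger
    then have "int D = 4 * (int D div 4) + 2 \<or> int D = 4 * (int D div 4) + 3"
      by presburger
    then show ?thesis using that by blast
  qed
  have "even x \<and> even y"
  proof (rule ccontr)
    assume "\<not> (even x \<and> even y)"
    then consider i j where "x = 2 * i + 1" "y = 2 * j" | i j where "x = 2 * i" "y = 2 * j + 1"
      | i j where "x = 2 * i + 1" "y = 2 * j + 1" by (metis evenE oddE)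
    then show False
    proof cases
      case 1
      then have "4 * (i\<^sup>2 + i - int D * j\<^sup>2 - n) + 1 = 0"
        using eq by (simp add: power2_eq_square algebra_simps)
      then show False by presburger
    next
      case 2
      then have "int D + 4 * (int D * j\<^sup>2 + int D * j - i\<^sup>2 + n) = 0"
        using eq by (simp add: power2_eq_square algebra_simps)
      then show False using e by presburger
    next
      case 3
      then have "int D - 1 + 4 * (int D * j\<^sup>2 + int D * j - i\<^sup>2 - i + n) = 0"
        using eq by (simp add: power2_eq_square algebra_simps)
      then show False using e by presburger
    qed
  qed
  then obtain i j where "x = 2 * i" "y = 2 * j" by (auto elim!: evenE)
  then show ?thesis using x y by auto
qed

lemma rational_powers_bounded_denominator:
  fixes x :: real
  assumes "x \<in> \<rat>" "N > (0::int)" "\<And>k. of_int N * x ^ k \<in> \<int>"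
  shows "x \<in> \<int>"
proof -
  obtain a b where ab: "b > 0" "coprime a b" "x = of_int a / of_int b"
    using assms(1) by (elim Rats_cases')
  have dvd: "b ^ k dvd N" for k
  proof -
    obtain l where "of_int N * x ^ k = of_int l"
      using assms(3)[of k] by (auto elim: Ints_cases)
    then have "real_of_int (N * a ^ k) = of_int (l * b ^ k)"
      using ab by (simp add: field_simps)
    then have "N * a ^ k = l * b ^ k" using of_int_eq_iff by blast
    then have "b ^ k dvd N * a ^ k" by simp
    moreover have "coprime (b ^ k) (a ^ k)"
      using ab(2) by (simp add: coprime_commute)
    ultimately show ?thesis using coprime_dvd_mult_left_iff by blast
  qed
  have "b = 1"
  proof (rule ccontr)
    assume "b \<noteq> 1"
    then have "b \<ge> 2" using ab(1) by simp
    have "N < 2 ^ nat N"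
      using of_nat_less_two_power[of "nat N", where 'a = int] assms(2) by simp
    also have "\<dots> \<le> b ^ nat N" using \<open>b \<ge> 2\<close> by (intro power_mono) auto
    also have "\<dots> \<le> N" using dvd assms(2) by (intro zdvd_imp_le)
    finally show False by simp
  qed
  then show ?thesis using ab(3) by simp
qed

lemma algebraic_int_quadratic:
  "algebraic_int (of_int w + of_int v * sqrt (real D))"
proof
  let ?f = "[:of_int (w\<^sup>2 - v\<^sup>2 * int D), of_int (- 2 * w), 1:] :: real poly"
  show "poly ?f (of_int w + of_int v * sqrt (real D)) = 0"
    by (simp add: power2_eq_square algebra_simps)
  show "\<forall>i. coeff ?f i \<in> \<int>"
    by (auto simp: coeff_pCons split: nat.splits)
qed simp

section \<open>Sums of squares in real quadratic orders\<close>

definition quadratic_totally_positive :: "nat \<Rightarrow> int \<Rightarrow> int \<Rightarrow> bool" where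
  "quadratic_totally_positive D w v \<longleftrightarrow>
     of_int w + of_int v * sqrt (real D) > 0 \<and> of_int w - of_int v * sqrt (real D) > 0"

definition quadratic_sum_of_squares :: "nat \<Rightarrow> int \<Rightarrow> int \<Rightarrow> bool" where
  "quadratic_sum_of_squares D w v \<longleftrightarrow>
     (\<exists>xs :: (int \<times> int) list. (\<Sum>(a, b)\<leftarrow>xs. a\<^sup>2 + int D * b\<^sup>2) = w \<and> (\<Sum>(a, b)\<leftarrow>xs. 2 * a * b) = v)"

lemma quadratic_sum_of_squares_add:
  assumes "quadratic_sum_of_squares D w v" "quadratic_sum_of_squares D w' v'"
  shows "quadratic_sum_of_squares D (w + w') (v + v')"
proof -
  obtain xs ys :: "(int \<times> int) list" where
    "(\<Sum>(a, b)\<leftarrow>xs. a\<^sup>2 + int D * b\<^sup>2) = w" "(\<Sum>(a, b)\<leftarrow>xs. 2 * a * b) = v"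
    "(\<Sum>(a, b)\<leftarrow>ys. a\<^sup>2 + int D * b\<^sup>2) = w'" "(\<Sum>(a, b)\<leftarrow>ys. 2 * a * b) = v'"
    using assms unfolding quadratic_sum_of_squares_def by blast
  then show ?thesis
    unfolding quadratic_sum_of_squares_def by (intro exI[of _ "xs @ ys"]) simp
qed

lemma quadratic_sum_of_squares_even:
  assumes "quadratic_sum_of_squares D w v"
  shows "even v"
proof -
  have "even (\<Sum>(a, b)\<leftarrow>xs. 2 * a * b)" for xs :: "(int \<times> int) list"
    by (induction xs) auto
  then show ?thesis
    using assms unfolding quadratic_sum_of_squares_def by blast
qed

lemma sum_list_form_square:
  fixes xs :: "(int \<times> int) list"
  shows "(\<Sum>(a, b)\<leftarrow>xs. (x * a + y * b)\<^sup>2) =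
    x\<^sup>2 * (\<Sum>(a, b)\<leftarrow>xs. a\<^sup>2) + 2 * x * y * (\<Sum>(a, b)\<leftarrow>xs. a * b) + y\<^sup>2 * (\<Sum>(a, b)\<leftarrow>xs. b\<^sup>2)"
  by (induction xs) (auto simp: power2_eq_square algebra_simps)

lemma sum_list_Cauchy_Schwarz:
  fixes xs :: "(int \<times> int) list"
  shows "(\<Sum>(a, b)\<leftarrow>xs. a * b)\<^sup>2 \<le> (\<Sum>(a, b)\<leftarrow>xs. a\<^sup>2) * (\<Sum>(a, b)\<leftarrow>xs. b\<^sup>2)"
proof -
  let ?A = "\<Sum>(a, b)\<leftarrow>xs. a\<^sup>2" and ?S = "\<Sum>(a, b)\<leftarrow>xs. a * b" and ?B = "\<Sum>(a, b)\<leftarrow>xs. b\<^sup>2"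
  have form: "x\<^sup>2 * ?A + 2 * x * y * ?S + y\<^sup>2 * ?B \<ge> 0" for x y
  proof -
    have "(\<Sum>(a, b)\<leftarrow>xs. (x * a + y * b)\<^sup>2) \<ge> 0"
      by (rule sum_list_nonneg) auto
    then show ?thesis by (simp only: sum_list_form_square)
  qed
  have A: "?A \<ge> 0" and B: "?B \<ge> 0" using form[of 1 0] form[of 0 1] by simp_all
  show ?thesis
  proof (cases "?B = 0")
    case True
    have "?S = 0"
    proof (rule ccontr)
      assume "?S \<noteq> 0"
      then have "?S\<^sup>2 > 0" by simp
      then have "?S\<^sup>2 \<ge> 1" by linarith
      have "?A - 2 * ((?A + 1) * ?S\<^sup>2) \<ge> 0"
        using form[of 1 "- (?A + 1) * ?S"] True by (simp add: power2_eq_square algebra_simps)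
      moreover have "(?A + 1) * ?S\<^sup>2 \<ge> ?A + 1"
        using A \<open>?S\<^sup>2 \<ge> 1\<close> mult_left_mono[of 1 "?S\<^sup>2" "?A + 1"] by simp
      ultimately show False using A by linarith
    qed
    then show ?thesis using True by simp
  next
    case False
    have "?B * (?A * ?B - ?S\<^sup>2) \<ge> 0"
      using form[of "?B" "- ?S"] by (simp add: power2_eq_square algebra_simps)
    then show ?thesis using False B by (simp add: zero_le_mult_iff)
  qed
qed

lemma quadratic_sum_of_squares_necessary:
  assumes "quadratic_sum_of_squares D (2 * s * w) (2 * s * v)" "s * v \<noteq> 0"
  obtains n :: int where "n \<ge> 1" "(s * v)\<^sup>2 \<le> n * (2 * s * w - int D * n)"
proof -
  obtain xs :: "(int \<times> int) list" where
    xs: "(\<Sum>(a, b)\<leftarrow>xs. a\<^sup>2 + int D * b\<^sup>2) = 2 * s * w" "(\<Sum>(a, b)\<leftarrow>xs. 2 * a * b) = 2 * s * v"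
    using assms unfolding quadratic_sum_of_squares_def by blast
  let ?A = "\<Sum>(a, b)\<leftarrow>xs. a\<^sup>2" and ?S = "\<Sum>(a, b)\<leftarrow>xs. a * b" and ?B = "\<Sum>(a, b)\<leftarrow>xs. b\<^sup>2"
  have "(\<Sum>(a, b)\<leftarrow>xs. a\<^sup>2 + int D * b\<^sup>2) = ?A + int D * ?B"
    by (induction xs) (auto simp: algebra_simps)
  then have A: "?A = 2 * s * w - int D * ?B" using xs by simp
  have "(\<Sum>(a, b)\<leftarrow>xs. 2 * a * b) = 2 * ?S"
    by (induction xs) (auto simp: algebra_simps)
  then have S: "?S = s * v" using xs by simp
  have CS: "(s * v)\<^sup>2 \<le> ?B * (2 * s * w - int D * ?B)"
    using sum_list_Cauchy_Schwarz[of xs] unfolding A S by (simp add: mult.commute)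
  have "?B \<ge> 0" by (rule sum_list_nonneg) auto
  moreover have "?B \<noteq> 0" using CS assms(2) by auto
  ultimately have "?B \<ge> 1" by linarith
  then show ?thesis using CS that by blast
qed

lemma exists_not_sum_of_squares_even:
  fixes s :: nat
  assumes irr: "sqrt (real D) \<notin> \<rat>" and s: "s > 0" and large: "sqrt (real D) \<ge> real s + 4"
  shows "\<exists>w v. quadratic_totally_positive D w v \<and> \<not> quadratic_sum_of_squares D (2 * int s * w) (2 * int s * v)"
proof -
  define P c S where "P = sqrt (real D)" and "c = P - real s" and "S = real s"
  define v where "v = \<lceil>2 * S / c\<^sup>2\<rceil>"
  define w where "w = \<lceil>of_int v * P\<rceil>"
  have c: "c \<ge> 4" and S: "S > 0" and P: "P = S + c" and PD: "P\<^sup>2 = real D"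
    using large s by (auto simp: c_def P_def S_def)
  then have P0: "P > 0" by linarith
  have v: "2 * S / c\<^sup>2 \<le> of_int v" "of_int v < 2 * S / c\<^sup>2 + 1"
    unfolding v_def by linarith+
  have "2 * S / c\<^sup>2 > 0" using S c by simp
  then have v0: "v > 0" unfolding v_def by simp
  have ne: "of_int v * P \<noteq> of_int w"
  proof
    assume "of_int v * P = of_int w"
    then have "P = of_int w / of_int v" using v0 by (simp add: field_simps)
    then show False using irr unfolding P_def by simp
  qed
  have \<delta>: "of_int w > of_int v * P" "of_int w < of_int v * P + 1"
    using ne unfolding w_def by linarith+
  have "of_int v * P > 0" using v0 P0 by simp
  then have pos: "quadratic_totally_positive D w v"
    unfolding quadratic_totally_positive_def P_def[symmetric] using \<delta> by linarith
  have "\<not> quadratic_sum_of_squares D (2 * int s * w) (2 * int s * v)"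
  proof
    assume "quadratic_sum_of_squares D (2 * int s * w) (2 * int s * v)"
    then obtain n :: int where n: "n \<ge> 1" "(int s * v)\<^sup>2 \<le> n * (2 * int s * w - int D * n)"
      using quadratic_sum_of_squares_necessary s v0
      by (metis mult_eq_0_iff of_nat_eq_0_iff less_numeral_extra(3))
    have "(S * of_int v)\<^sup>2 \<le> of_int n * (2 * S * of_int w - real D * of_int n)"
      using n(2) unfolding S_def
      by (metis (mono_tags, lifting) of_int_diff of_int_le_iff of_int_mult of_int_numeral of_int_of_nat_eq of_int_power)
    then have "(P * of_int n - S * of_int v)\<^sup>2 \<le> 2 * S * of_int n * (of_int w - of_int v * P)"
      unfolding PD[symmetric] by (simp add: power2_eq_square algebra_simps)
    also have "\<dots> < 2 * S * of_int n * 1"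
      using \<delta> S n(1) by (intro mult_strict_left_mono) auto
    finally have less: "(P * of_int n - S * of_int v)\<^sup>2 < 2 * S * of_int n" by simp
    show False
    proof (cases "n \<ge> v")
      case True
      have "P * of_int n - S * of_int v = S * (of_int n - of_int v) + c * of_int n"
        unfolding P by (simp add: algebra_simps)
      moreover have "S * (of_int n - of_int v) \<ge> 0" using True S by simp
      moreover have "c * of_int n \<ge> 0" using c n(1) by simp
      ultimately have "(c * of_int n)\<^sup>2 \<le> (P * of_int n - S * of_int v)\<^sup>2"
        by (intro power_mono) auto
      moreover have "2 * S * of_int n \<le> (c * of_int n)\<^sup>2"
      proof -
        have "2 * S \<le> c\<^sup>2 * of_int v" using v(1) c by (simp add: field_simps)
        also have "\<dots> \<le> c\<^sup>2 * of_int n" using True by (intro mult_left_mono) auto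
        finally have "2 * S * of_int n \<le> c\<^sup>2 * of_int n * of_int n"
          using n(1) by (intro mult_right_mono) auto
        then show ?thesis by (simp add: power2_eq_square algebra_simps)
      qed
      ultimately show False using less by linarith
    next
      case False
      then have nv: "of_int n \<le> real_of_int v - 1" by linarith
      have n_less: "of_int n < 2 * S / c\<^sup>2" using nv v(2) by linarith
      have "c * of_int n < c * (2 * S / c\<^sup>2)" using n_less c by (intro mult_strict_left_mono) auto
      also have "\<dots> = 2 * S / c" using c by (simp add: power2_eq_square field_simps)
      finally have cn: "c * of_int n < 2 * S / c" .
      have "4 * S \<le> c * S" using c S by (intro mult_right_mono) auto
      then have "4 * S / c \<le> S" using c by (simp add: field_simps)
      moreover have "S * 1 \<le> S * (of_int v - of_int n)"
        using nv S by (intro mult_left_mono) auto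
      moreover have "4 * S / c = 2 * S / c + 2 * S / c" by simp
      ultimately have "2 * S / c \<le> S * (of_int v - of_int n) - c * of_int n"
        using cn by linarith
      also have "\<dots> = S * of_int v - P * of_int n" unfolding P by (simp add: algebra_simps)
      finally have "(2 * S / c)\<^sup>2 \<le> (S * of_int v - P * of_int n)\<^sup>2"
        using c S by (intro power_mono) auto
      moreover have "2 * S * of_int n < 2 * S * (2 * S / c\<^sup>2)"
        using n_less S by (intro mult_strict_left_mono) auto
      moreover have "2 * S * (2 * S / c\<^sup>2) = (2 * S / c)\<^sup>2"
        by (simp add: power2_eq_square)
      ultimately show False using less by (simp add: power2_commute)
    qed
  qed
  then show ?thesis using pos by blast
qed

lemma exists_not_sum_of_squares:
  fixes m :: nat
  assumes irr: "sqrt (real D) \<notin> \<rat>" and m: "m > 0" and large: "sqrt (real D) \<ge> real m / 2 + 4"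
  shows "\<exists>w v. quadratic_totally_positive D w v \<and> \<not> quadratic_sum_of_squares D (int m * w) (int m * v)"
proof (cases "even m")
  case True
  then obtain s where "m = 2 * s" by blast
  then show ?thesis using exists_not_sum_of_squares_even[OF irr, of s] m large by simp
next
  case False
  let ?w = "\<lceil>sqrt (real D)\<rceil>"
  have "sqrt (real D) \<noteq> of_int ?w" using irr by (metis Rats_of_int)
  then have "sqrt (real D) < of_int ?w" by linarith
  then have "quadratic_totally_positive D ?w 1"
    unfolding quadratic_totally_positive_def using large m by simp
  moreover have "\<not> quadratic_sum_of_squares D (int m * ?w) (int m * 1)"
    using quadratic_sum_of_squares_even False by fastforce
  ultimately show ?thesis by blast
qed

lemma exists_indecomposable_not_sum_of_squares:
  fixes m :: nat
  assumes "sqrt (real D) \<notin> \<rat>" "m > 0" "sqrt (real D) \<ge> real m / 2 + 4"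
  shows "\<exists>w v. quadratic_totally_positive D w v \<and>
    \<not> quadratic_sum_of_squares D (int m * w) (int m * v) \<and>
    (\<forall>x y. quadratic_totally_positive D x y \<longrightarrow> \<not> quadratic_totally_positive D (w - x) (v - y))"
proof -
  define Q where "Q = (\<lambda>(w, v). quadratic_totally_positive D w v \<and>
    \<not> quadratic_sum_of_squares D (int m * w) (int m * v))"
  have pos: "w > 0" if "quadratic_totally_positive D w v" for w v
    using that unfolding quadratic_totally_positive_def by linarith
  obtain wv where "Q wv" using exists_not_sum_of_squares[OF assms] unfolding Q_def by auto
  then obtain w v where Q: "Q (w, v)" and least: "\<And>x y. Q (x, y) \<Longrightarrow> nat w \<le> nat x"
    using ex_has_least_nat[of Q wv "\<lambda>(w, v). nat w"] by auto
  have "\<not> quadratic_totally_positive D (w - x) (v - y)" if xy: "quadratic_totally_positive D x y" for x y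
  proof
    assume xy': "quadratic_totally_positive D (w - x) (v - y)"
    have "x > 0" "w - x > 0" using pos[OF xy] pos[OF xy'] by auto
    then have "\<not> Q (x, y)" "\<not> Q (w - x, v - y)" using least by fastforce+
    then have "quadratic_sum_of_squares D (int m * x + int m * (w - x)) (int m * y + int m * (v - y))"
      using xy xy' unfolding Q_def by (intro quadratic_sum_of_squares_add) auto
    then show False using Q unfolding Q_def by (simp add: algebra_simps)
  qed
  then show ?thesis using Q unfolding Q_def by blast
qed

lemma sum_list_ge_member:
  fixes f :: "'a \<Rightarrow> real"
  assumes "y \<in> set xs" "\<And>x. x \<in> set xs \<Longrightarrow> f x \<ge> 0"
  shows "f y \<le> (\<Sum>x\<leftarrow>xs. f x)"
  using assms
proof (induction xs)
  case (Cons a xs)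
  have "(\<Sum>x\<leftarrow>xs. f x) \<ge> 0" using Cons.prems by (intro sum_list_nonneg) auto
  then show ?case using Cons by fastforce
qed simp

text \<open>Each pair \<open>(x y, z y)\<close> encodes a totally positive element whose \<open>T\<close>-fold multiple is bounded
  by \<open>m\<close> times the indecomposable element; as \<open>T > m\<close>, it could be split off.\<close>

lemma indecomposable_no_mixed_representation:
  fixes xs :: "'a list" and a b :: "'a \<Rightarrow> real" and x z :: "'a \<Rightarrow> int" and T :: real
  assumes irr: "sqrt (real D) \<notin> \<rat>" and m: "m > 0"
    and not_sum: "\<not> quadratic_sum_of_squares D (int m * w) (int m * v)"
    and indec: "\<forall>x y. quadratic_totally_positive D x y \<longrightarrow> \<not> quadratic_totally_positive D (w - x) (v - y)"
    and T: "T > real m"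
    and sum: "\<And>e. e \<in> {1, -1} \<Longrightarrow>
      (\<Sum>y\<leftarrow>xs. (a y + e * b y * sqrt (real D))\<^sup>2 + T * (of_int (x y) + e * of_int (z y) * sqrt (real D)))
        = real m * (of_int w + e * of_int v * sqrt (real D))"
    and cases: "\<And>y. y \<in> set xs \<Longrightarrow> quadratic_totally_positive D (x y) (z y) \<or>
      (x y = 0 \<and> z y = 0 \<and> a y \<in> \<int> \<and> b y \<in> \<int>)"
  shows False
proof -
  have T0: "T > 0" using T by linarith
  have ge0: "of_int (x y) + e * of_int (z y) * sqrt (real D) \<ge> 0" if "y \<in> set xs" "e \<in> {1, -1}" for y and e :: real
    using cases[OF that(1)] that(2) unfolding quadratic_totally_positive_def by auto
  have zero: "x y = 0 \<and> z y = 0 \<and> a y \<in> \<int> \<and> b y \<in> \<int>" if y: "y \<in> set xs" for y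
  proof (rule ccontr)
    assume "\<not> ?thesis"
    then have pos: "quadratic_totally_positive D (x y) (z y)" using cases[OF y] by blast
    have less: "of_int (x y) + e * of_int (z y) * sqrt (real D) < of_int w + e * of_int v * sqrt (real D)"
      if e: "e \<in> {1, -1}" for e :: real
    proof -
      let ?f = "\<lambda>y. (a y + e * b y * sqrt (real D))\<^sup>2 + T * (of_int (x y) + e * of_int (z y) * sqrt (real D))"
      let ?\<beta> = "of_int (x y) + e * of_int (z y) * sqrt (real D)"
      have "?\<beta> > 0" using pos e unfolding quadratic_totally_positive_def by auto
      then have "real m * ?\<beta> < T * ?\<beta>" using T by (intro mult_strict_right_mono)
      also have "\<dots> \<le> ?f y" by simp
      also have "\<dots> \<le> (\<Sum>y\<leftarrow>xs. ?f y)"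
        using y ge0[OF _ e] T0 by (intro sum_list_ge_member) auto
      also have "\<dots> = real m * (of_int w + e * of_int v * sqrt (real D))" by (rule sum[OF e])
      finally show ?thesis using m by simp
    qed
    have "quadratic_totally_positive D (w - x y) (v - z y)"
      using less[of 1] less[of "-1"] unfolding quadratic_totally_positive_def
      by (simp add: algebra_simps)
    then show False using indec pos by blast
  qed
  define A B where "A = (\<lambda>y. \<lfloor>a y\<rfloor>)" and "B = (\<lambda>y. \<lfloor>b y\<rfloor>)"
  have AB: "a y = of_int (A y)" "b y = of_int (B y)" if "y \<in> set xs" for y
    using zero[OF that] unfolding A_def B_def by (auto elim!: Ints_cases)
  have sq: "(of_int (\<Sum>y\<leftarrow>xs. (A y)\<^sup>2 + int D * (B y)\<^sup>2) :: real) + e * of_int (\<Sum>y\<leftarrow>xs. 2 * A y * B y) * sqrt (real D)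
      = real m * (of_int w + e * of_int v * sqrt (real D))" if e: "e \<in> {1, -1}" for e
  proof -
    have "(of_int (\<Sum>y\<leftarrow>ys. (A y)\<^sup>2 + int D * (B y)\<^sup>2) :: real) + e * of_int (\<Sum>y\<leftarrow>ys. 2 * A y * B y) * sqrt (real D)
      = (\<Sum>y\<leftarrow>ys. (of_int (A y) + e * of_int (B y) * sqrt (real D))\<^sup>2)" for ys
    proof (induction ys)
      case (Cons y ys)
      have "(of_int (A y) + e * of_int (B y) * sqrt (real D))\<^sup>2
          = of_int ((A y)\<^sup>2) + (e * e) * (real D * of_int ((B y)\<^sup>2)) + e * (2 * of_int (A y) * of_int (B y)) * sqrt (real D)"
        by (simp add: power2_eq_square algebra_simps)
      moreover have "e * e = 1" using e by auto
      ultimately show ?case using Cons by (simp add: algebra_simps)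
    qed simp
    moreover have "(\<Sum>y\<leftarrow>xs. (of_int (A y) + e * of_int (B y) * sqrt (real D))\<^sup>2) =
       (\<Sum>y\<leftarrow>xs. (a y + e * b y * sqrt (real D))\<^sup>2 + T * (of_int (x y) + e * of_int (z y) * sqrt (real D)))"
      using zero AB by (intro arg_cong[where f = sum_list] map_cong) auto
    ultimately show ?thesis using sum[OF e] by simp
  qed
  define SA SB where "SA = (\<Sum>y\<leftarrow>xs. (A y)\<^sup>2 + int D * (B y)\<^sup>2)" and "SB = (\<Sum>y\<leftarrow>xs. 2 * A y * B y)"
  have 1: "real_of_int SA + of_int SB * sqrt (real D) = real m * (of_int w + of_int v * sqrt (real D))"
   and 2: "real_of_int SA - of_int SB * sqrt (real D) = real m * (of_int w - of_int v * sqrt (real D))"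
    using sq[of 1] sq[of "-1"] unfolding SA_def SB_def by simp_all
  have "real_of_int SA = of_int (int m * w)" using 1 2 by (simp add: algebra_simps)
  then have SA: "SA = int m * w" using of_int_eq_iff by blast
  have "sqrt (real D) \<noteq> 0" using irr by (metis Rats_0)
  moreover have "real_of_int SB * sqrt (real D) = real m * (of_int v * sqrt (real D))"
    using 1 2 unfolding distrib_left right_diff_distrib by linarith
  then have "real_of_int SB * sqrt (real D) = of_int (int m * v) * sqrt (real D)"
    by simp
  ultimately have SB: "SB = int m * v" by (metis mult_cancel_right of_int_eq_iff)
  have "(\<Sum>(a, b)\<leftarrow>map (\<lambda>y. (A y, B y)) xs. a\<^sup>2 + int D * b\<^sup>2) = SA"
    "(\<Sum>(a, b)\<leftarrow>map (\<lambda>y. (A y, B y)) xs. 2 * a * b) = SB"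
    unfolding SA_def SB_def by (simp_all add: comp_def)
  then have "quadratic_sum_of_squares D (int m * w) (int m * v)"
    unfolding quadratic_sum_of_squares_def SA SB by blast
  then show False using not_sum by blast
qed

section \<open>Totally positive elements of quadratic fields\<close>

lemma real_field_simps [simp]:
  "carrier real_field = UNIV" "x \<otimes>\<^bsub>real_field\<^esub> y = x * y" "\<one>\<^bsub>real_field\<^esub> = 1"
  "\<zero>\<^bsub>real_field\<^esub> = 0" "x \<oplus>\<^bsub>real_field\<^esub> y = x + y"
  by (simp_all add: ring_of_type_algebra_def)

lemma real_field_a_inv [simp]: "\<ominus>\<^bsub>real_field\<^esub> x = - x"
proof -
  interpret ring real_field by (rule ring_from_type_algebra)
  show ?thesis by (rule minus_equality) auto
qed

lemma real_field_m_inv [simp]: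
  assumes "x \<noteq> 0"
  shows "inv\<^bsub>real_field\<^esub> x = inverse x"
proof -
  interpret cring real_field by (rule cring_from_type_algebra)
  show ?thesis using assms by (intro comm_inv_char) auto
qed

lemma rat_adjoin_closed:
  shows "x \<in> S \<Longrightarrow> x \<in> rat_adjoin S"
    and "1 \<in> rat_adjoin S"
    and "x \<in> rat_adjoin S \<Longrightarrow> - x \<in> rat_adjoin S"
    and "x \<in> rat_adjoin S \<Longrightarrow> y \<in> rat_adjoin S \<Longrightarrow> x + y \<in> rat_adjoin S"
    and "x \<in> rat_adjoin S \<Longrightarrow> y \<in> rat_adjoin S \<Longrightarrow> x * y \<in> rat_adjoin S"
  unfolding rat_adjoin_def
  using generate_field.incl[of x S real_field] generate_field.one[of real_field S]
    generate_field.a_inv[of x real_field S] generate_field.eng_add[of x real_field S y]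
    generate_field.eng_mult[of x real_field S y] by simp_all

lemma rat_adjoin_of_int: "of_int k \<in> rat_adjoin S"
proof -
  have nat: "real n \<in> rat_adjoin S" for n
  proof (induction n)
    case 0
    have "1 + - 1 \<in> rat_adjoin S" by (intro rat_adjoin_closed)
    then show ?case by simp
  next
    case (Suc n)
    then have "real n + 1 \<in> rat_adjoin S" by (intro rat_adjoin_closed(2,4))
    then show ?case by (simp add: add.commute)
  qed
  show ?thesis
    using nat[of "nat k"] rat_adjoin_closed(3)[OF nat[of "nat (- k)"]] by (cases "k \<ge> 0") auto
qed

lemma real_embedding_of_int:
  assumes "\<sigma> \<in> real_embeddings (rat_adjoin S)"
  shows "\<sigma> (of_int k) = of_int k"
proof -
  have add: "\<sigma> (x + y) = \<sigma> x + \<sigma> y" if "x \<in> rat_adjoin S" "y \<in> rat_adjoin S" for x y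
    using assms that ring_hom_add[of \<sigma> "real_field\<lparr>carrier := rat_adjoin S\<rparr>" real_field x y]
    unfolding real_embeddings_def by simp
  have one: "\<sigma> 1 = 1"
    using assms ring_hom_one[of \<sigma> "real_field\<lparr>carrier := rat_adjoin S\<rparr>" real_field]
    unfolding real_embeddings_def by simp
  have zero: "\<sigma> 0 = 0"
    using add[of 0 0] rat_adjoin_of_int[of 0 S] by simp
  have nat: "\<sigma> (real n) = real n" for n
  proof (induction n)
    case (Suc n)
    then show ?case
      using add[of "real n" 1] one rat_adjoin_of_int[of "int n" S] rat_adjoin_closed(2)
      by (simp add: add.commute)
  qed (simp add: zero)
  show ?thesis
  proof (cases "k \<ge> 0")
    case True
    then show ?thesis using nat[of "nat k"] by simp
  next
    case False
    then show ?thesis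
      using nat[of "nat (- k)"] add[of "of_int k" "of_int (- k)"] zero
        rat_adjoin_of_int[of k S] rat_adjoin_of_int[of "- k" S] by simp
  qed
qed

lemma totally_positive_integers_quadratic:
  assumes "quadratic_totally_positive D w v"
  shows "of_int w + of_int v * sqrt (real D) \<in> totally_positive_integers (rat_adjoin {sqrt (real D)})"
    (is "?\<alpha> \<in> totally_positive_integers ?F")
proof -
  have mem: "of_int k \<in> ?F" "sqrt (real D) \<in> ?F" for k
    using rat_adjoin_of_int rat_adjoin_closed by auto
  then have "?\<alpha> \<in> ?F" by (intro rat_adjoin_closed(4,5))
  moreover have "\<sigma> ?\<alpha> > 0" if \<sigma>: "\<sigma> \<in> real_embeddings ?F" for \<sigma>
  proof -
    have add: "\<sigma> (x + y) = \<sigma> x + \<sigma> y" and mult: "\<sigma> (x * y) = \<sigma> x * \<sigma> y"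
      if "x \<in> ?F" "y \<in> ?F" for x y
      using \<sigma> that ring_hom_add[of \<sigma> "real_field\<lparr>carrier := ?F\<rparr>" real_field x y]
        ring_hom_mult[of \<sigma> "real_field\<lparr>carrier := ?F\<rparr>" real_field x y]
      unfolding real_embeddings_def by simp_all
    have "\<sigma> (sqrt (real D)) * \<sigma> (sqrt (real D)) = \<sigma> (of_int (int D))"
      using mult[OF mem(2) mem(2)] by simp
    then have "(\<sigma> (sqrt (real D)))\<^sup>2 = (sqrt (real D))\<^sup>2"
      using real_embedding_of_int[OF \<sigma>, of "int D"] by (simp add: power2_eq_square)
    then have "\<sigma> (sqrt (real D)) = sqrt (real D) \<or> \<sigma> (sqrt (real D)) = - sqrt (real D)"
      using power2_eq_iff by blast
    moreover have "\<sigma> ?\<alpha> = of_int w + of_int v * \<sigma> (sqrt (real D))"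
      using add[OF mem(1) rat_adjoin_closed(5)[OF mem]] mult[OF mem]
      by (simp add: real_embedding_of_int[OF \<sigma>])
    ultimately show ?thesis
      using assms unfolding quadratic_totally_positive_def by auto
  qed
  ultimately show ?thesis
    unfolding totally_positive_integers_def ring_of_integers_def
    using algebraic_int_quadratic by blast
qed

section \<open>Integers of the biquadratic field\<close>

lemma integral_basis_parity:
  fixes x\<^sub>0 x\<^sub>1 x\<^sub>2 x\<^sub>3 :: int and p q r q' :: nat
  assumes "p mod 4 = 2" "q mod 4 = 3" "r mod 4 = 2" "odd q'"
    and dvd: "4 dvd x\<^sub>0\<^sup>2 + int p * x\<^sub>1\<^sup>2 - int q * x\<^sub>2\<^sup>2 - int r * x\<^sub>3\<^sup>2"
    and even: "even (x\<^sub>0 * x\<^sub>1 - int q' * x\<^sub>2 * x\<^sub>3)"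
  shows "even x\<^sub>0 \<and> even x\<^sub>2 \<and> even (x\<^sub>1 + x\<^sub>3)"
proof -
  have ex: "\<exists>k. int n = 4 * k + int (n mod 4)" for n :: nat
    by (intro exI[of _ "int (n div 4)"]) presburger
  obtain k l j where pqr: "int p = 4 * k + 2" "int q = 4 * l + 3" "int r = 4 * j + 2"
    using ex[of p] ex[of q] ex[of r] assms(1-3) by auto
  have sq: "\<exists>t. x\<^sup>2 = 4 * t + x mod 2" for x :: int
  proof (cases "even x")
    case True
    then obtain y where "x = 2 * y" by blast
    then show ?thesis by (intro exI[of _ "y\<^sup>2"]) (simp add: power2_eq_square)
  next
    case False
    then obtain y where "x = 2 * y + 1" by (elim oddE)
    then show ?thesis by (intro exI[of _ "y\<^sup>2 + y"]) (simp add: power2_eq_square algebra_simps)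
  qed
  obtain t\<^sub>0 t\<^sub>1 t\<^sub>2 t\<^sub>3 where t: "x\<^sub>0\<^sup>2 = 4 * t\<^sub>0 + x\<^sub>0 mod 2" "x\<^sub>1\<^sup>2 = 4 * t\<^sub>1 + x\<^sub>1 mod 2"
    "x\<^sub>2\<^sup>2 = 4 * t\<^sub>2 + x\<^sub>2 mod 2" "x\<^sub>3\<^sup>2 = 4 * t\<^sub>3 + x\<^sub>3 mod 2"
    using sq by metis
  have "x\<^sub>0\<^sup>2 + int p * x\<^sub>1\<^sup>2 - int q * x\<^sub>2\<^sup>2 - int r * x\<^sub>3\<^sup>2 =
    4 * (k * x\<^sub>1\<^sup>2 - l * x\<^sub>2\<^sup>2 - j * x\<^sub>3\<^sup>2 - x\<^sub>2\<^sup>2 - x\<^sub>3\<^sup>2) + (x\<^sub>0\<^sup>2 + 2 * x\<^sub>1\<^sup>2 + x\<^sub>2\<^sup>2 + 2 * x\<^sub>3\<^sup>2)"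
    unfolding pqr by (simp add: algebra_simps)
  then have "4 dvd x\<^sub>0\<^sup>2 + 2 * x\<^sub>1\<^sup>2 + x\<^sub>2\<^sup>2 + 2 * x\<^sub>3\<^sup>2"
    using dvd by (metis dvd_add_right_iff dvd_triv_left)
  then have main: "4 dvd x\<^sub>0 mod 2 + 2 * (x\<^sub>1 mod 2) + x\<^sub>2 mod 2 + 2 * (x\<^sub>3 mod 2)"
    unfolding t by presburger
  have "\<not> (odd x\<^sub>0 \<and> odd x\<^sub>2)"
  proof
    assume odd: "odd x\<^sub>0 \<and> odd x\<^sub>2"
    then have "even x\<^sub>1 \<longleftrightarrow> even x\<^sub>3" using even assms(4) by simp
    then show False using main odd by presburger
  qed
  then show ?thesis using main by presburger
qed

locale biquadratic_field =
  fixes g p' q' :: nat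
  assumes squarefree: "squarefree (g * p')" "squarefree (g * q')" "squarefree (p' * q')"
    and mod4: "g * p' mod 4 = 2" "g * q' mod 4 = 3" "p' * q' mod 4 = 2"
begin

definition P :: real where "P = sqrt (real (g * p'))"
definition Q :: real where "Q = sqrt (real (g * q'))"
definition R :: real where "R = sqrt (real (p' * q'))"

lemma mult_roots:
  "P * P = real g * real p'" "Q * Q = real g * real q'" "R * R = real p' * real q'"
  "P * Q = real g * R" "P * R = real p' * Q" "Q * R = real q' * P"
  unfolding P_def Q_def R_def by (simp_all add: real_sqrt_mult mult_ac)

lemma roots_irrational: "P \<notin> \<rat>" "Q \<notin> \<rat>" "R \<notin> \<rat>"
  unfolding P_def Q_def R_def using mod4 by (intro sqrt_nat_irrational; simp)+

text \<open>The signs \<open>e\<^sub>1\<close> and \<open>e\<^sub>2\<close> of \<open>P\<close> and \<open>Q\<close> parametrise the four conjugates of an element.\<close>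

definition elt :: "real \<Rightarrow> real \<Rightarrow> real \<Rightarrow> real \<Rightarrow> real \<Rightarrow> real \<Rightarrow> real" where
  "elt a b c d e\<^sub>1 e\<^sub>2 = a + e\<^sub>1 * b * P + e\<^sub>2 * c * Q + e\<^sub>1 * e\<^sub>2 * d * R"

definition conjugates :: "real set \<Rightarrow> (real \<Rightarrow> real \<Rightarrow> real) set" where
  "conjugates S = {f. \<exists>a\<in>S. \<exists>b\<in>S. \<exists>c\<in>S. \<exists>d\<in>S.
     \<forall>e\<^sub>1\<in>{1, -1}. \<forall>e\<^sub>2\<in>{1, -1}. f e\<^sub>1 e\<^sub>2 = elt a b c d e\<^sub>1 e\<^sub>2}"

lemma conjugatesI:
  assumes "a \<in> S" "b \<in> S" "c \<in> S" "d \<in> S"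
    "\<And>e\<^sub>1 e\<^sub>2. e\<^sub>1 \<in> {1, -1} \<Longrightarrow> e\<^sub>2 \<in> {1, -1} \<Longrightarrow> f e\<^sub>1 e\<^sub>2 = elt a b c d e\<^sub>1 e\<^sub>2"
  shows "f \<in> conjugates S"
  using assms unfolding conjugates_def by blast

lemma conjugatesE:
  assumes "f \<in> conjugates S"
  obtains a b c d where "a \<in> S" "b \<in> S" "c \<in> S" "d \<in> S"
    "\<And>e\<^sub>1 e\<^sub>2. e\<^sub>1 \<in> {1, -1} \<Longrightarrow> e\<^sub>2 \<in> {1, -1} \<Longrightarrow> f e\<^sub>1 e\<^sub>2 = elt a b c d e\<^sub>1 e\<^sub>2"
  using assms unfolding conjugates_def by blast

lemma conjugates_cong:
  assumes "f \<in> conjugates S" "\<And>e\<^sub>1 e\<^sub>2. e\<^sub>1 \<in> {1, -1} \<Longrightarrow> e\<^sub>2 \<in> {1, -1} \<Longrightarrow> h e\<^sub>1 e\<^sub>2 = f e\<^sub>1 e\<^sub>2"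
  shows "h \<in> conjugates S"
  using assms by (elim conjugatesE) (rule conjugatesI; simp)

lemma elt_mult:
  assumes "e\<^sub>1 \<in> {1, -1}" "e\<^sub>2 \<in> {1, -1}"
  shows "elt a b c d e\<^sub>1 e\<^sub>2 * elt a' b' c' d' e\<^sub>1 e\<^sub>2 = elt
    (a * a' + real g * real p' * b * b' + real g * real q' * c * c' + real p' * real q' * d * d')
    (a * b' + b * a' + real q' * (c * d' + d * c'))
    (a * c' + c * a' + real p' * (b * d' + d * b'))
    (a * d' + d * a' + real g * (b * c' + c * b')) e\<^sub>1 e\<^sub>2"
proof -
  define x y z where "x = e\<^sub>1 * P" and "y = e\<^sub>2 * Q" and "z = e\<^sub>1 * e\<^sub>2 * R"
  have rel: "x * x = real g * real p'" "y * y = real g * real q'" "z * z = real p' * real q'"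
    "x * y = real g * z" "x * z = real p' * y" "y * z = real q' * x"
    using assms mult_roots unfolding x_def y_def z_def by auto
  have elt: "elt a b c d e\<^sub>1 e\<^sub>2 = a + b * x + c * y + d * z" for a b c d
    unfolding elt_def x_def y_def z_def by (simp add: algebra_simps)
  have "(a + b * x + c * y + d * z) * (a' + b' * x + c' * y + d' * z) =
    a * a' + b * b' * (x * x) + c * c' * (y * y) + d * d' * (z * z)
    + (a * b' + b * a') * x + (a * c' + c * a') * y + (a * d' + d * a') * z
    + (b * c' + c * b') * (x * y) + (b * d' + d * b') * (x * z) + (c * d' + d * c') * (y * z)"
    by (simp add: algebra_simps)
  then show ?thesis unfolding elt rel by (simp add: algebra_simps)
qed

definition coeff_ring :: "real set \<Rightarrow> bool" where
  "coeff_ring S \<longleftrightarrow> \<nat> \<subseteq> S \<and> (\<forall>x\<in>S. \<forall>y\<in>S. x + y \<in> S \<and> x * y \<in> S)"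

lemma coeff_ring_Ints: "coeff_ring \<int>" and coeff_ring_Rats: "coeff_ring \<rat>"
  unfolding coeff_ring_def using Nats_subset_Ints Nats_subset_Rats by auto

lemma conjugates_const: "coeff_ring S \<Longrightarrow> x \<in> S \<Longrightarrow> (\<lambda>e\<^sub>1 e\<^sub>2. x) \<in> conjugates S"
  by (rule conjugatesI[of x _ 0 0 0]) (auto simp: elt_def coeff_ring_def)

lemma conjugates_add:
  assumes "coeff_ring S" "f \<in> conjugates S" "h \<in> conjugates S"
  shows "(\<lambda>e\<^sub>1 e\<^sub>2. f e\<^sub>1 e\<^sub>2 + h e\<^sub>1 e\<^sub>2) \<in> conjugates S"
proof -
  obtain a b c d where f: "a \<in> S" "b \<in> S" "c \<in> S" "d \<in> S"
    "\<And>e\<^sub>1 e\<^sub>2. e\<^sub>1 \<in> {1, -1} \<Longrightarrow> e\<^sub>2 \<in> {1, -1} \<Longrightarrow> f e\<^sub>1 e\<^sub>2 = elt a b c d e\<^sub>1 e\<^sub>2"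
    using assms(2) by (elim conjugatesE) blast
  obtain a' b' c' d' where h: "a' \<in> S" "b' \<in> S" "c' \<in> S" "d' \<in> S"
    "\<And>e\<^sub>1 e\<^sub>2. e\<^sub>1 \<in> {1, -1} \<Longrightarrow> e\<^sub>2 \<in> {1, -1} \<Longrightarrow> h e\<^sub>1 e\<^sub>2 = elt a' b' c' d' e\<^sub>1 e\<^sub>2"
    using assms(3) by (elim conjugatesE) blast
  show ?thesis
    using assms(1) f(1-4) h(1-4) unfolding coeff_ring_def
    by (intro conjugatesI[of "a + a'" _ "b + b'" "c + c'" "d + d'"])
      (simp_all add: f(5) h(5) elt_def algebra_simps)
qed

lemma conjugates_mult:
  assumes "coeff_ring S" "f \<in> conjugates S" "h \<in> conjugates S"
  shows "(\<lambda>e\<^sub>1 e\<^sub>2. f e\<^sub>1 e\<^sub>2 * h e\<^sub>1 e\<^sub>2) \<in> conjugates S"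
proof -
  obtain a b c d where f: "a \<in> S" "b \<in> S" "c \<in> S" "d \<in> S"
    "\<And>e\<^sub>1 e\<^sub>2. e\<^sub>1 \<in> {1, -1} \<Longrightarrow> e\<^sub>2 \<in> {1, -1} \<Longrightarrow> f e\<^sub>1 e\<^sub>2 = elt a b c d e\<^sub>1 e\<^sub>2"
    using assms(2) by (elim conjugatesE) blast
  obtain a' b' c' d' where h: "a' \<in> S" "b' \<in> S" "c' \<in> S" "d' \<in> S"
    "\<And>e\<^sub>1 e\<^sub>2. e\<^sub>1 \<in> {1, -1} \<Longrightarrow> e\<^sub>2 \<in> {1, -1} \<Longrightarrow> h e\<^sub>1 e\<^sub>2 = elt a' b' c' d' e\<^sub>1 e\<^sub>2"
    using assms(3) by (elim conjugatesE) blast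
  have add: "x + y \<in> S" and mult: "x * y \<in> S" if "x \<in> S" "y \<in> S" for x y
    using assms(1) that unfolding coeff_ring_def by auto
  have nat: "real n \<in> S" for n
    using assms(1) unfolding coeff_ring_def by auto
  show ?thesis
    by (rule conjugatesI[of
      "a * a' + real g * real p' * b * b' + real g * real q' * c * c' + real p' * real q' * d * d'" S
      "a * b' + b * a' + real q' * (c * d' + d * c')"
      "a * c' + c * a' + real p' * (b * d' + d * b')"
      "a * d' + d * a' + real g * (b * c' + c * b')"])
      ((intro add mult nat f(1-4) h(1-4))+, simp only: f(5) h(5) elt_mult)
qed

lemma conjugates_power:
  assumes "coeff_ring S" "f \<in> conjugates S"
  shows "(\<lambda>e\<^sub>1 e\<^sub>2. f e\<^sub>1 e\<^sub>2 ^ k) \<in> conjugates S"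
proof (induction k)
  case 0
  have "1 \<in> S" using assms(1) unfolding coeff_ring_def by auto
  then show ?case using conjugates_const[OF assms(1), of 1] by simp
next
  case (Suc k)
  then show ?case using conjugates_mult[OF assms(1) assms(2)] by simp
qed

lemma conjugates_sum:
  assumes "coeff_ring S" "finite I" "\<And>i. i \<in> I \<Longrightarrow> f i \<in> conjugates S"
  shows "(\<lambda>e\<^sub>1 e\<^sub>2. \<Sum>i\<in>I. f i e\<^sub>1 e\<^sub>2) \<in> conjugates S"
  using assms(2,3)
proof (induction I rule: finite_induct)
  case empty
  have "0 \<in> S" using assms(1) unfolding coeff_ring_def by auto
  then show ?case using conjugates_const[OF assms(1), of 0] by simp
next
  case (insert i I)
  then show ?case using conjugates_add[OF assms(1), of "f i"] by simp
qed

lemma conjugates_sum_list: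
  assumes "coeff_ring S" "\<And>i. i \<in> set xs \<Longrightarrow> f i \<in> conjugates S"
  shows "(\<lambda>e\<^sub>1 e\<^sub>2. \<Sum>i\<leftarrow>xs. f i e\<^sub>1 e\<^sub>2) \<in> conjugates S"
  using assms(2)
proof (induction xs)
  case Nil
  have "0 \<in> S" using assms(1) unfolding coeff_ring_def by auto
  then show ?case using conjugates_const[OF assms(1), of 0] by simp
next
  case (Cons i xs)
  then show ?case using conjugates_add[OF assms(1), of "f i"] by simp
qed

lemma conjugates_flip:
  assumes "coeff_ring S" "- 1 \<in> S" "f \<in> conjugates S" "s\<^sub>1 \<in> {1, -1}" "s\<^sub>2 \<in> {1, -1}"
  shows "(\<lambda>e\<^sub>1 e\<^sub>2. f (s\<^sub>1 * e\<^sub>1) (s\<^sub>2 * e\<^sub>2)) \<in> conjugates S"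
proof -
  obtain a b c d where f: "a \<in> S" "b \<in> S" "c \<in> S" "d \<in> S"
    "\<And>e\<^sub>1 e\<^sub>2. e\<^sub>1 \<in> {1, -1} \<Longrightarrow> e\<^sub>2 \<in> {1, -1} \<Longrightarrow> f e\<^sub>1 e\<^sub>2 = elt a b c d e\<^sub>1 e\<^sub>2"
    using assms(3) by (elim conjugatesE) blast
  have "1 \<in> S" using assms(1) unfolding coeff_ring_def by auto
  then have s: "s\<^sub>1 \<in> S" "s\<^sub>2 \<in> S" using assms by auto
  have mult: "x * y \<in> S" if "x \<in> S" "y \<in> S" for x y
    using assms(1) that unfolding coeff_ring_def by auto
  show ?thesis
  proof (rule conjugatesI[of a _ "s\<^sub>1 * b" "s\<^sub>2 * c" "s\<^sub>1 * s\<^sub>2 * d"])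
    fix e\<^sub>1 e\<^sub>2 :: real assume "e\<^sub>1 \<in> {1, -1}" "e\<^sub>2 \<in> {1, -1}"
    then have "s\<^sub>1 * e\<^sub>1 \<in> {1, -1}" "s\<^sub>2 * e\<^sub>2 \<in> {1, -1}" using assms by auto
    then show "f (s\<^sub>1 * e\<^sub>1) (s\<^sub>2 * e\<^sub>2) = elt a (s\<^sub>1 * b) (s\<^sub>2 * c) (s\<^sub>1 * s\<^sub>2 * d) e\<^sub>1 e\<^sub>2"
      by (simp only: f(5) elt_def) (simp add: mult_ac)
  qed (intro f mult s)+
qed

lemma rational_quadratic_independent:
  fixes x y t :: real
  assumes "x \<in> \<rat>" "y \<in> \<rat>" "t \<notin> \<rat>" "x + y * t = 0"
  shows "x = 0 \<and> y = 0"
proof -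
  have "y = 0"
  proof (rule ccontr)
    assume "y \<noteq> 0"
    moreover have "y * t = - x" using assms(4) by linarith
    ultimately have "t = - x / y" by (metis nonzero_mult_div_cancel_left)
    then show False using assms by simp
  qed
  then show ?thesis using assms(4) by simp
qed

lemma elt_independent:
  assumes rat: "a \<in> \<rat>" "b \<in> \<rat>" "c \<in> \<rat>" "d \<in> \<rat>" and zero: "elt a b c d 1 1 = 0"
  shows "a = 0 \<and> b = 0 \<and> c = 0 \<and> d = 0"
proof -
  have sum: "a + b * P + c * Q + d * R = 0" using zero unfolding elt_def by simp
  have 1: "a\<^sup>2 + real g * real p' * b\<^sup>2 = real g * real q' * c\<^sup>2 + real p' * real q' * d\<^sup>2"
  proof -
    have "(a\<^sup>2 + b\<^sup>2 * (P * P) - c\<^sup>2 * (Q * Q) - d\<^sup>2 * (R * R)) + 2 * (a * b * P - c * d * (Q * R))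
      = (a + b * P + c * Q + d * R) * (a + b * P - c * Q - d * R)"
      by (simp add: power2_eq_square algebra_simps)
    then have "(a\<^sup>2 + real g * real p' * b\<^sup>2 - real g * real q' * c\<^sup>2 - real p' * real q' * d\<^sup>2)
        + (2 * (a * b - real q' * (c * d))) * P = 0"
      unfolding sum mult_roots by (simp add: algebra_simps)
    from rational_quadratic_independent[OF _ _ roots_irrational(1) this] rat show ?thesis by simp
  qed
  have 2: "a\<^sup>2 + real g * real q' * c\<^sup>2 = real g * real p' * b\<^sup>2 + real p' * real q' * d\<^sup>2"
  proof -
    have "(a\<^sup>2 + c\<^sup>2 * (Q * Q) - b\<^sup>2 * (P * P) - d\<^sup>2 * (R * R)) + 2 * (a * c * Q - b * d * (P * R))
      = (a + b * P + c * Q + d * R) * (a + c * Q - b * P - d * R)"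
      by (simp add: power2_eq_square algebra_simps)
    then have "(a\<^sup>2 + real g * real q' * c\<^sup>2 - real g * real p' * b\<^sup>2 - real p' * real q' * d\<^sup>2)
        + (2 * (a * c - real p' * (b * d))) * Q = 0"
      unfolding sum mult_roots by (simp add: algebra_simps)
    from rational_quadratic_independent[OF _ _ roots_irrational(2) this] rat show ?thesis by simp
  qed
  have 3: "a\<^sup>2 + real p' * real q' * d\<^sup>2 = real g * real p' * b\<^sup>2 + real g * real q' * c\<^sup>2"
  proof -
    have "(a\<^sup>2 + d\<^sup>2 * (R * R) - b\<^sup>2 * (P * P) - c\<^sup>2 * (Q * Q)) + 2 * (a * d * R - b * c * (P * Q))
      = (a + b * P + c * Q + d * R) * (a + d * R - b * P - c * Q)"
      by (simp add: power2_eq_square algebra_simps)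
    then have "(a\<^sup>2 + real p' * real q' * d\<^sup>2 - real g * real p' * b\<^sup>2 - real g * real q' * c\<^sup>2)
        + (2 * (a * d - real g * (b * c))) * R = 0"
      unfolding sum mult_roots by (simp add: algebra_simps)
    from rational_quadratic_independent[OF _ _ roots_irrational(3) this] rat show ?thesis by simp
  qed
  have zero': "x = 0 \<and> y = 0" if "x \<in> \<rat>" "y \<in> \<rat>" "t \<notin> \<rat>" "x\<^sup>2 = y\<^sup>2 * (t * t)" for x y t :: real
  proof -
    have "(x + y * t) * (x - y * t) = 0" using that(4) by (simp add: power2_eq_square algebra_simps)
    then have "x + y * t = 0 \<or> x + (- y) * t = 0" by auto
    then show ?thesis
      using rational_quadratic_independent[of x y t] rational_quadratic_independent[of x "- y" t] that
      by auto
  qed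
  have "a\<^sup>2 = b\<^sup>2 * (P * P)" "a\<^sup>2 = c\<^sup>2 * (Q * Q)" "a\<^sup>2 = d\<^sup>2 * (R * R)"
    unfolding mult_roots using 1 2 3 by (simp_all add: mult_ac)
  then show ?thesis using zero' rat roots_irrational by metis
qed

lemma conjugates_zero:
  assumes "f \<in> conjugates \<rat>" "f s\<^sub>1 s\<^sub>2 = 0" "s\<^sub>1 \<in> {1, -1}" "s\<^sub>2 \<in> {1, -1}" "e\<^sub>1 \<in> {1, -1}" "e\<^sub>2 \<in> {1, -1}"
  shows "f e\<^sub>1 e\<^sub>2 = 0"
proof -
  obtain a b c d where f: "a \<in> \<rat>" "b \<in> \<rat>" "c \<in> \<rat>" "d \<in> \<rat>"
    "\<And>e\<^sub>1 e\<^sub>2. e\<^sub>1 \<in> {1, -1} \<Longrightarrow> e\<^sub>2 \<in> {1, -1} \<Longrightarrow> f e\<^sub>1 e\<^sub>2 = elt a b c d e\<^sub>1 e\<^sub>2"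
    using assms(1) by (elim conjugatesE) blast
  have s: "s\<^sub>1 \<in> \<rat>" "s\<^sub>2 \<in> \<rat>" "s\<^sub>1 \<noteq> 0" "s\<^sub>2 \<noteq> 0" using assms by auto
  have "elt a (s\<^sub>1 * b) (s\<^sub>2 * c) (s\<^sub>1 * s\<^sub>2 * d) 1 1 = 0"
    using f(5)[OF assms(3,4)] assms(2) unfolding elt_def by simp
  then have "a = 0 \<and> s\<^sub>1 * b = 0 \<and> s\<^sub>2 * c = 0 \<and> s\<^sub>1 * s\<^sub>2 * d = 0"
    using f(1-4) s by (intro elt_independent) auto
  then show ?thesis using f(5)[OF assms(5,6)] s unfolding elt_def by simp
qed

lemma elt_conjugates: "a \<in> S \<Longrightarrow> b \<in> S \<Longrightarrow> c \<in> S \<Longrightarrow> d \<in> S \<Longrightarrow> elt a b c d \<in> conjugates S"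
  by (rule conjugatesI) auto

lemma conjugates_inverse:
  assumes "f \<in> conjugates \<rat>" "f 1 1 \<noteq> 0"
  shows "\<exists>h \<in> conjugates \<rat>. h 1 1 = inverse (f 1 1)"
proof -
  obtain a b c d where f: "a \<in> \<rat>" "b \<in> \<rat>" "c \<in> \<rat>" "d \<in> \<rat>"
    "\<And>e\<^sub>1 e\<^sub>2. e\<^sub>1 \<in> {1, -1} \<Longrightarrow> e\<^sub>2 \<in> {1, -1} \<Longrightarrow> f e\<^sub>1 e\<^sub>2 = elt a b c d e\<^sub>1 e\<^sub>2"
    using assms(1) by (elim conjugatesE) blast
  define A B where "A = a * a + real g * real p' * b * b - real g * real q' * c * c - real p' * real q' * d * d"
    and "B = 2 * a * b - 2 * real q' * c * d"
  define \<rho> where "\<rho> = A * A - real g * real p' * B * B"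
  have AB: "A \<in> \<rat>" "B \<in> \<rat>" "\<rho> \<in> \<rat>" using f(1-4) unfolding A_def B_def \<rho>_def by auto
  have eq: "f 1 1 * f 1 (-1) = A + B * P"
  proof -
    have "f 1 (-1) = elt a b (- c) (- d) 1 1"
      using f(5) unfolding elt_def by simp
    then have "f 1 1 * f 1 (-1) = elt a b c d 1 1 * elt a b (- c) (- d) 1 1"
      using f(5) by simp
    also have "\<dots> = A + B * P"
      by (subst elt_mult) (simp_all add: elt_def A_def B_def algebra_simps)
    finally show ?thesis .
  qed
  have "f 1 (-1) \<noteq> 0"
    using conjugates_zero[OF assms(1), of 1 "-1" 1 1] assms(2) by auto
  then have ne: "A + B * P \<noteq> 0" using eq assms(2) by (metis mult_eq_0_iff)
  have "A - B * P \<noteq> 0"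
  proof
    assume "A - B * P = 0"
    then have "A + (- B) * P = 0" by simp
    then show False
      using rational_quadratic_independent[of A "- B" P] AB(1,2) roots_irrational(1) ne by simp
  qed
  have \<rho>: "\<rho> = (A + B * P) * (A - B * P)"
  proof -
    have "(A + B * P) * (A - B * P) = A * A - B * B * (P * P)" by (simp add: algebra_simps)
    then show ?thesis unfolding mult_roots \<rho>_def by (simp add: mult_ac)
  qed
  then have "\<rho> \<noteq> 0" using ne \<open>A - B * P \<noteq> 0\<close> by simp
  define h where "h = (\<lambda>e\<^sub>1 e\<^sub>2. elt a b (- c) (- d) e\<^sub>1 e\<^sub>2 * elt (A / \<rho>) (- B / \<rho>) 0 0 e\<^sub>1 e\<^sub>2)"
  have "h \<in> conjugates \<rat>"
    unfolding h_def using f(1-4) AB by (intro conjugates_mult coeff_ring_Rats elt_conjugates) auto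
  moreover have "h 1 1 * f 1 1 = 1"
  proof -
    have "h 1 1 = f 1 (-1) * ((A - B * P) / \<rho>)"
      using f(5) unfolding h_def elt_def by (simp add: diff_divide_distrib)
    then have "h 1 1 * f 1 1 = (f 1 1 * f 1 (-1)) * (A - B * P) / \<rho>" by simp
    also have "\<dots> = 1" unfolding eq using \<rho> \<open>\<rho> \<noteq> 0\<close> by simp
    finally show ?thesis .
  qed
  ultimately show ?thesis using assms(2) by (metis inverse_unique mult.commute)
qed

lemma rat_adjoin_subset:
  assumes "x \<in> rat_adjoin {P, Q}"
  shows "\<exists>f \<in> conjugates \<rat>. x = f 1 1"
  using assms unfolding rat_adjoin_def
proof (induction rule: generate_field.induct)
  case one
  then show ?case using conjugates_const[OF coeff_ring_Rats Rats_1] by force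
next
  case (incl h)
  have "elt 0 1 0 0 \<in> conjugates \<rat>" "elt 0 0 1 0 \<in> conjugates \<rat>"
    by (intro elt_conjugates Rats_0 Rats_1)+
  moreover have "h = elt 0 1 0 0 1 1 \<or> h = elt 0 0 1 0 1 1"
    using incl unfolding elt_def by auto
  ultimately show ?case by blast
next
  case (a_inv h)
  then obtain f where f: "f \<in> conjugates \<rat>" "h = f 1 1" by blast
  have "(\<lambda>e\<^sub>1 e\<^sub>2. (-1) * f e\<^sub>1 e\<^sub>2) \<in> conjugates \<rat>"
    using f(1) by (intro conjugates_mult[OF coeff_ring_Rats] conjugates_const[OF coeff_ring_Rats]) auto
  then show ?case using f(2) by force
next
  case (m_inv h)
  then obtain f where "f \<in> conjugates \<rat>" "h = f 1 1" by blast
  moreover have "h \<noteq> 0" using m_inv(2) by simp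
  ultimately obtain f' where "f' \<in> conjugates \<rat>" "f' 1 1 = inverse h" using conjugates_inverse by blast
  moreover have "inv\<^bsub>real_field\<^esub> h = inverse h" using \<open>h \<noteq> 0\<close> by (rule real_field_m_inv)
  ultimately show ?case by metis
next
  case (eng_add h1 h2)
  then obtain f1 f2 where f: "f1 \<in> conjugates \<rat>" "h1 = f1 1 1" "f2 \<in> conjugates \<rat>" "h2 = f2 1 1" by blast
  show ?case
    by (rule bexI[OF _ conjugates_add[OF coeff_ring_Rats f(1,3)]]) (simp add: f(2,4))
next
  case (eng_mult h1 h2)
  then obtain f1 f2 where f: "f1 \<in> conjugates \<rat>" "h1 = f1 1 1" "f2 \<in> conjugates \<rat>" "h2 = f2 1 1" by blast
  show ?case
    by (rule bexI[OF _ conjugates_mult[OF coeff_ring_Rats f(1,3)]]) (simp add: f(2,4))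
qed

text \<open>The libraries do not have that sums and products of algebraic integers are algebraic integers.
  Bounded denominators of all powers are a substitute that is easily seen to be closed under the
  ring operations.\<close>

definition almost_integral :: "(real \<Rightarrow> real \<Rightarrow> real) \<Rightarrow> bool" where
  "almost_integral f \<longleftrightarrow> (\<exists>N>0::int. \<forall>k. (\<lambda>e\<^sub>1 e\<^sub>2. of_int N * f e\<^sub>1 e\<^sub>2 ^ k) \<in> conjugates \<int>)"

lemma almost_integral_mult:
  assumes "almost_integral f" "almost_integral h"
  shows "almost_integral (\<lambda>e\<^sub>1 e\<^sub>2. f e\<^sub>1 e\<^sub>2 * h e\<^sub>1 e\<^sub>2)"
proof -
  obtain M N :: int where "M > 0" "N > 0"
    and M: "\<And>k. (\<lambda>e\<^sub>1 e\<^sub>2. of_int M * f e\<^sub>1 e\<^sub>2 ^ k) \<in> conjugates \<int>"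
    and N: "\<And>k. (\<lambda>e\<^sub>1 e\<^sub>2. of_int N * h e\<^sub>1 e\<^sub>2 ^ k) \<in> conjugates \<int>"
    using assms unfolding almost_integral_def by blast
  have "(\<lambda>e\<^sub>1 e\<^sub>2. of_int (M * N) * (f e\<^sub>1 e\<^sub>2 * h e\<^sub>1 e\<^sub>2) ^ k) \<in> conjugates \<int>" for k
    using conjugates_mult[OF coeff_ring_Ints M N, of k k]
    by (rule conjugates_cong) (simp add: power_mult_distrib)
  then show ?thesis
    unfolding almost_integral_def using \<open>M > 0\<close> \<open>N > 0\<close> by (intro exI[of _ "M * N"]) simp
qed

lemma almost_integral_add:
  assumes "almost_integral f" "almost_integral h"
  shows "almost_integral (\<lambda>e\<^sub>1 e\<^sub>2. f e\<^sub>1 e\<^sub>2 + h e\<^sub>1 e\<^sub>2)"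
proof -
  obtain M N :: int where "M > 0" "N > 0"
    and M: "\<And>k. (\<lambda>e\<^sub>1 e\<^sub>2. of_int M * f e\<^sub>1 e\<^sub>2 ^ k) \<in> conjugates \<int>"
    and N: "\<And>k. (\<lambda>e\<^sub>1 e\<^sub>2. of_int N * h e\<^sub>1 e\<^sub>2 ^ k) \<in> conjugates \<int>"
    using assms unfolding almost_integral_def by blast
  have "(\<lambda>e\<^sub>1 e\<^sub>2. of_int (M * N) * (f e\<^sub>1 e\<^sub>2 + h e\<^sub>1 e\<^sub>2) ^ k) \<in> conjugates \<int>" for k
  proof -
    have "(\<lambda>e\<^sub>1 e\<^sub>2. \<Sum>i\<le>k. of_nat (k choose i) *
        ((of_int M * f e\<^sub>1 e\<^sub>2 ^ i) * (of_int N * h e\<^sub>1 e\<^sub>2 ^ (k - i)))) \<in> conjugates \<int>"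
      by (intro conjugates_sum conjugates_mult[OF coeff_ring_Ints] conjugates_const M N coeff_ring_Ints) auto
    then show ?thesis
      by (rule conjugates_cong) (simp add: binomial_ring sum_distrib_left mult_ac)
  qed
  then show ?thesis
    unfolding almost_integral_def using \<open>M > 0\<close> \<open>N > 0\<close> by (intro exI[of _ "M * N"]) simp
qed

lemma almost_integral_flip:
  assumes "almost_integral f" "s\<^sub>1 \<in> {1, -1}" "s\<^sub>2 \<in> {1, -1}"
  shows "almost_integral (\<lambda>e\<^sub>1 e\<^sub>2. f (s\<^sub>1 * e\<^sub>1) (s\<^sub>2 * e\<^sub>2))"
proof -
  obtain N :: int where "N > 0"
    and N: "\<And>k. (\<lambda>e\<^sub>1 e\<^sub>2. of_int N * f e\<^sub>1 e\<^sub>2 ^ k) \<in> conjugates \<int>"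
    using assms unfolding almost_integral_def by blast
  have "(\<lambda>e\<^sub>1 e\<^sub>2. of_int N * f (s\<^sub>1 * e\<^sub>1) (s\<^sub>2 * e\<^sub>2) ^ k) \<in> conjugates \<int>" for k
    using conjugates_flip[OF coeff_ring_Ints _ N assms(2,3), of k] by simp
  then show ?thesis unfolding almost_integral_def using \<open>N > 0\<close> by blast
qed

lemma almost_integral_rational:
  assumes "almost_integral f" "x \<in> \<rat>" "f 1 1 = x"
  shows "x \<in> \<int>"
proof -
  obtain N :: int where "N > 0"
    and N: "\<And>k. (\<lambda>e\<^sub>1 e\<^sub>2. of_int N * f e\<^sub>1 e\<^sub>2 ^ k) \<in> conjugates \<int>"
    using assms unfolding almost_integral_def by blast
  have "of_int N * x ^ k \<in> \<int>" for k
  proof -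
    obtain a b c d where abcd: "a \<in> \<int>" "b \<in> \<int>" "c \<in> \<int>" "d \<in> \<int>"
      "\<And>e\<^sub>1 e\<^sub>2. e\<^sub>1 \<in> {1, -1} \<Longrightarrow> e\<^sub>2 \<in> {1, -1} \<Longrightarrow> of_int N * f e\<^sub>1 e\<^sub>2 ^ k = elt a b c d e\<^sub>1 e\<^sub>2"
      using N[of k] by (elim conjugatesE) blast
    have "elt (a - of_int N * x ^ k) b c d 1 1 = 0"
      using abcd(5)[of 1 1] assms(3) unfolding elt_def by simp
    moreover have "a - of_int N * x ^ k \<in> \<rat>" "b \<in> \<rat>" "c \<in> \<rat>" "d \<in> \<rat>"
      using abcd(1-4) assms(2) Ints_subset_Rats by (auto intro!: Rats_diff)
    ultimately have "a - of_int N * x ^ k = 0"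
      using elt_independent by blast
    then show ?thesis using abcd(1) by simp
  qed
  then show ?thesis using rational_powers_bounded_denominator \<open>N > 0\<close> assms(2) by blast
qed

lemma conjugates_clear_denominator:
  assumes "f \<in> conjugates \<rat>"
  shows "\<exists>N>0::int. (\<lambda>e\<^sub>1 e\<^sub>2. of_int N * f e\<^sub>1 e\<^sub>2) \<in> conjugates \<int>"
proof -
  have den: "\<exists>n>0::int. of_int n * x \<in> \<int>" if "x \<in> \<rat>" for x :: real
  proof -
    obtain a b where "b > 0" "x = of_int a / of_int b" using \<open>x \<in> \<rat>\<close> by (elim Rats_cases')
    then show ?thesis by (intro exI[of _ b]) auto
  qed
  obtain a b c d where f: "a \<in> \<rat>" "b \<in> \<rat>" "c \<in> \<rat>" "d \<in> \<rat>"
    "\<And>e\<^sub>1 e\<^sub>2. e\<^sub>1 \<in> {1, -1} \<Longrightarrow> e\<^sub>2 \<in> {1, -1} \<Longrightarrow> f e\<^sub>1 e\<^sub>2 = elt a b c d e\<^sub>1 e\<^sub>2"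
    using assms(1) by (elim conjugatesE) blast
  obtain i j k l :: int where pos: "i > 0" "j > 0" "k > 0" "l > 0"
    and int: "of_int i * a \<in> \<int>" "of_int j * b \<in> \<int>" "of_int k * c \<in> \<int>" "of_int l * d \<in> \<int>"
    using den f(1-4) by metis
  define N where "N = i * j * k * l"
  have "of_int N * a = of_int (j * k * l) * (of_int i * a)" "of_int N * b = of_int (i * k * l) * (of_int j * b)"
    "of_int N * c = of_int (i * j * l) * (of_int k * c)" "of_int N * d = of_int (i * j * k) * (of_int l * d)"
    unfolding N_def by simp_all
  then have "of_int N * a \<in> \<int>" "of_int N * b \<in> \<int>" "of_int N * c \<in> \<int>" "of_int N * d \<in> \<int>"
    using int by (metis Ints_mult Ints_of_int)+
  then have "(\<lambda>e\<^sub>1 e\<^sub>2. of_int N * f e\<^sub>1 e\<^sub>2) \<in> conjugates \<int>"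
    by (rule conjugatesI) (simp add: f(5) elt_def algebra_simps)
  moreover have "N > 0" unfolding N_def using pos by simp
  ultimately show ?thesis by blast
qed

lemma almost_integral_algebraic_int:
  assumes f: "f \<in> conjugates \<rat>" and "algebraic_int (f 1 1)"
  shows "almost_integral f"
proof -
  obtain F :: "real poly" where F: "lead_coeff F = 1" "\<And>i. coeff F i \<in> \<int>" "poly F (f 1 1) = 0"
    using assms(2) by (auto elim: algebraic_int.cases)
  define n where "n = degree F"
  have "(\<lambda>e\<^sub>1 e\<^sub>2. \<Sum>i\<le>n. coeff F i * f e\<^sub>1 e\<^sub>2 ^ i) \<in> conjugates \<rat>"
    using F(2) Ints_subset_Rats
    by (intro conjugates_sum conjugates_mult conjugates_const conjugates_power coeff_ring_Rats f) auto
  from conjugates_zero[OF this, of 1 1]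
  have root: "(\<Sum>i\<le>n. coeff F i * f e\<^sub>1 e\<^sub>2 ^ i) = 0" if "e\<^sub>1 \<in> {1, -1}" "e\<^sub>2 \<in> {1, -1}" for e\<^sub>1 e\<^sub>2
    using F(3) that unfolding n_def poly_altdef by blast
  have reduce: "f e\<^sub>1 e\<^sub>2 ^ n = (\<Sum>i<n. - coeff F i * f e\<^sub>1 e\<^sub>2 ^ i)"
    if "e\<^sub>1 \<in> {1, -1}" "e\<^sub>2 \<in> {1, -1}" for e\<^sub>1 e\<^sub>2
  proof -
    have "{..n} = insert n {..<n}" by auto
    then have "f e\<^sub>1 e\<^sub>2 ^ n + (\<Sum>i<n. coeff F i * f e\<^sub>1 e\<^sub>2 ^ i) = 0"
      using root[OF that] F(1) unfolding n_def by simp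
    then show ?thesis by (simp add: sum_negf)
  qed
  obtain M :: "nat \<Rightarrow> int" where M: "\<And>i. M i > 0" "\<And>i. (\<lambda>e\<^sub>1 e\<^sub>2. of_int (M i) * f e\<^sub>1 e\<^sub>2 ^ i) \<in> conjugates \<int>"
    using conjugates_clear_denominator[OF conjugates_power[OF coeff_ring_Rats f]] by metis
  define N where "N = (\<Prod>i<n. M i)"
  have "N > 0" unfolding N_def using M(1) by (intro prod_pos) auto
  have "(\<lambda>e\<^sub>1 e\<^sub>2. of_int N * f e\<^sub>1 e\<^sub>2 ^ k) \<in> conjugates \<int>" for k
  proof (induction k rule: less_induct)
    case (less k)
    show ?case
    proof (cases "k < n")
      case True
      then have "N = (\<Prod>i\<in>{..<n} - {k}. M i) * M k"
        unfolding N_def by (subst prod.remove[of _ k]) auto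
      then have "real_of_int N * x = of_int (\<Prod>i\<in>{..<n} - {k}. M i) * (of_int (M k) * x)" for x
        by simp
      then show ?thesis
        using conjugates_mult[OF coeff_ring_Ints
            conjugates_const[OF coeff_ring_Ints, of "of_int (\<Prod>i\<in>{..<n} - {k}. M i)"] M(2)[of k]]
        by (simp only: Ints_of_int simp_thms)
    next
      case False
      have "(\<lambda>e\<^sub>1 e\<^sub>2. \<Sum>i<n. - coeff F i * (of_int N * f e\<^sub>1 e\<^sub>2 ^ (k - n + i))) \<in> conjugates \<int>"
        using F(2) False
        by (intro conjugates_sum conjugates_mult[OF coeff_ring_Ints] conjugates_const less.IH coeff_ring_Ints) auto
      then show ?thesis
      proof (rule conjugates_cong)
        fix e\<^sub>1 e\<^sub>2 :: real assume e: "e\<^sub>1 \<in> {1, -1}" "e\<^sub>2 \<in> {1, -1}"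
        have "of_int N * f e\<^sub>1 e\<^sub>2 ^ k = of_int N * f e\<^sub>1 e\<^sub>2 ^ (k - n) * f e\<^sub>1 e\<^sub>2 ^ n"
          using False by (simp flip: power_add)
        also have "\<dots> = (\<Sum>i<n. - coeff F i * (of_int N * f e\<^sub>1 e\<^sub>2 ^ (k - n + i)))"
          unfolding reduce[OF e] by (simp add: sum_distrib_left power_add mult_ac)
        finally show "of_int N * f e\<^sub>1 e\<^sub>2 ^ k = (\<Sum>i<n. - coeff F i * (of_int N * f e\<^sub>1 e\<^sub>2 ^ (k - n + i)))" .
      qed
    qed
  qed
  then show ?thesis unfolding almost_integral_def using \<open>N > 0\<close> by blast
qed

lemma almost_integral_quadratic:
  assumes "almost_integral f" "almost_integral h" "A \<in> \<rat>" "B \<in> \<rat>"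
    and "f 1 1 = A + B * t" "h 1 1 = A - B * t" "t * t = real D"
    and "squarefree D" "D mod 4 = 2 \<or> D mod 4 = 3"
  shows "A \<in> \<int> \<and> B \<in> \<int>"
proof (rule quadratic_integer_coeffs[OF assms(8,9,3,4)])
  show "2 * A \<in> \<int>"
    using almost_integral_rational[OF almost_integral_add[OF assms(1,2)], of "2 * A"] assms(3,5,6) by simp
  have "(A + B * t) * (A - B * t) = A\<^sup>2 - (t * t) * B\<^sup>2"
    by (simp add: power2_eq_square algebra_simps)
  then have "f 1 1 * h 1 1 = A\<^sup>2 - real D * B\<^sup>2" unfolding assms(5-7) .
  then show "A\<^sup>2 - real D * B\<^sup>2 \<in> \<int>"
    using almost_integral_rational[OF almost_integral_mult[OF assms(1,2)], of "A\<^sup>2 - real D * B\<^sup>2"] assms(3,4)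
    by simp
qed

lemma odd_factors: "odd g" "odd q'" "even p'"
proof -
  have "odd (g * q')" "even (g * p')" using mod4 by presburger+
  then show "odd g" "odd q'" "even p'" by auto
qed

lemma integral_basis:
  assumes "y \<in> ring_of_integers (rat_adjoin {P, Q})"
  shows "\<exists>a b c d :: int. even (b + d) \<and> y = elt (of_int a) (of_int b / 2) (of_int c) (of_int d / 2) 1 1"
proof -
  obtain f' where "f' \<in> conjugates \<rat>" "y = f' 1 1"
    using assms rat_adjoin_subset unfolding ring_of_integers_def by blast
  then obtain a b c d where rat: "a \<in> \<rat>" "b \<in> \<rat>" "c \<in> \<rat>" "d \<in> \<rat>" and y: "y = elt a b c d 1 1"
    by (elim conjugatesE) auto
  define f where "f = elt a b c d"
  have f: "almost_integral f"
    using assms y rat elt_conjugates unfolding f_def ring_of_integers_def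
    by (intro almost_integral_algebraic_int) auto
  have fl: "almost_integral (\<lambda>e\<^sub>1 e\<^sub>2. f (- e\<^sub>1) e\<^sub>2)" "almost_integral (\<lambda>e\<^sub>1 e\<^sub>2. f e\<^sub>1 (- e\<^sub>2))"
    "almost_integral (\<lambda>e\<^sub>1 e\<^sub>2. f (- e\<^sub>1) (- e\<^sub>2))"
    using almost_integral_flip[OF f, of "-1" 1] almost_integral_flip[OF f, of 1 "-1"]
      almost_integral_flip[OF f, of "-1" "-1"] by simp_all
  have "2 * a \<in> \<int> \<and> 2 * b \<in> \<int>"
    using rat squarefree(1) mod4
    by (intro almost_integral_quadratic[OF almost_integral_add[OF f fl(2)] almost_integral_add[OF fl(1,3)],
          of _ _ P "g * p'"]) (simp_all add: f_def elt_def mult_roots)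
  moreover have "2 * a \<in> \<int> \<and> 2 * c \<in> \<int>"
    using rat squarefree(2) mod4
    by (intro almost_integral_quadratic[OF almost_integral_add[OF f fl(1)] almost_integral_add[OF fl(2,3)],
          of _ _ Q "g * q'"]) (simp_all add: f_def elt_def mult_roots)
  moreover have "2 * a \<in> \<int> \<and> 2 * d \<in> \<int>"
    using rat squarefree(3) mod4
    by (intro almost_integral_quadratic[OF almost_integral_add[OF f fl(3)] almost_integral_add[OF fl(1,2)],
          of _ _ R "p' * q'"]) (simp_all add: f_def elt_def mult_roots)
  ultimately obtain x\<^sub>0 x\<^sub>1 x\<^sub>2 x\<^sub>3 where
    x: "2 * a = of_int x\<^sub>0" "2 * b = of_int x\<^sub>1" "2 * c = of_int x\<^sub>2" "2 * d = of_int x\<^sub>3"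
    by (auto elim!: Ints_cases)
  define A B where "A = a * a + real g * real p' * b * b - real g * real q' * c * c - real p' * real q' * d * d"
    and "B = 2 * a * b - 2 * real q' * c * d"
  have AB: "A \<in> \<int> \<and> B \<in> \<int>"
  proof (rule almost_integral_quadratic[OF almost_integral_mult[OF f fl(2)] almost_integral_mult[OF fl(1,3)],
          of _ _ P "g * p'"])
    show "A \<in> \<rat>" "B \<in> \<rat>" using rat unfolding A_def B_def by auto
    have "f 1 (-1) = elt a b (- c) (- d) 1 1" "f (-1) 1 = elt a (- b) c (- d) 1 1"
      "f (-1) (-1) = elt a (- b) (- c) d 1 1"
      unfolding f_def elt_def by simp_all
    then show "f 1 1 * f 1 (-1) = A + B * P" "f (-1) 1 * f (-1) (-1) = A - B * P"
      unfolding f_def A_def B_def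
      by (simp_all add: elt_mult) (simp_all add: elt_def algebra_simps)
  qed (use squarefree(1) mod4 mult_roots in auto)
  then obtain A' B' where A': "A = of_int A'" and B': "B = of_int B'" by (auto elim!: Ints_cases)
  have "4 * A = (2 * a)\<^sup>2 + real (g * p') * (2 * b)\<^sup>2 - real (g * q') * (2 * c)\<^sup>2 - real (p' * q') * (2 * d)\<^sup>2"
    unfolding A_def by (simp add: power2_eq_square)
  then have "real_of_int (x\<^sub>0\<^sup>2 + int (g * p') * x\<^sub>1\<^sup>2 - int (g * q') * x\<^sub>2\<^sup>2 - int (p' * q') * x\<^sub>3\<^sup>2) = of_int (4 * A')"
    unfolding x A' by simp
  then have "x\<^sub>0\<^sup>2 + int (g * p') * x\<^sub>1\<^sup>2 - int (g * q') * x\<^sub>2\<^sup>2 - int (p' * q') * x\<^sub>3\<^sup>2 = 4 * A'"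
    using of_int_eq_iff by blast
  then have dvd: "4 dvd x\<^sub>0\<^sup>2 + int (g * p') * x\<^sub>1\<^sup>2 - int (g * q') * x\<^sub>2\<^sup>2 - int (p' * q') * x\<^sub>3\<^sup>2"
    by simp
  have "2 * B = (2 * a) * (2 * b) - real q' * (2 * c) * (2 * d)"
    unfolding B_def by simp
  then have "real_of_int (x\<^sub>0 * x\<^sub>1 - int q' * x\<^sub>2 * x\<^sub>3) = of_int (2 * B')"
    unfolding x B' by simp
  then have "x\<^sub>0 * x\<^sub>1 - int q' * x\<^sub>2 * x\<^sub>3 = 2 * B'"
    using of_int_eq_iff by blast
  then have "even (x\<^sub>0 * x\<^sub>1 - int q' * x\<^sub>2 * x\<^sub>3)" by simp
  with dvd have par: "even x\<^sub>0 \<and> even x\<^sub>2 \<and> even (x\<^sub>1 + x\<^sub>3)"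
    using integral_basis_parity mod4 odd_factors(2) by blast
  then obtain a' c' where "x\<^sub>0 = 2 * a'" "x\<^sub>2 = 2 * c'" by (auto elim!: evenE)
  then have "a = of_int a'" "b = of_int x\<^sub>1 / 2" "c = of_int c'" "d = of_int x\<^sub>3 / 2" using x by auto
  then show ?thesis using par y by blast
qed

section \<open>Sums of squares in the biquadratic field\<close>

lemma sum_of_squares_conjugates:
  assumes "h 1 1 \<in> sums_of_squares (ring_of_integers (rat_adjoin {P, Q}))" "h \<in> conjugates \<rat>"
  shows "\<exists>(xs :: real list) (a :: real \<Rightarrow> int) (b :: real \<Rightarrow> int) (c :: real \<Rightarrow> int) (d :: real \<Rightarrow> int).
    (\<forall>y\<in>set xs. even (b y + d y)) \<and>
    (\<forall>e\<^sub>1\<in>{1, -1}. \<forall>e\<^sub>2\<in>{1, -1}.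
      (\<Sum>y\<leftarrow>xs. (elt (of_int (a y)) (of_int (b y) / 2) (of_int (c y)) (of_int (d y) / 2) e\<^sub>1 e\<^sub>2)\<^sup>2) = h e\<^sub>1 e\<^sub>2)"
proof -
  obtain xs where xs: "set xs \<subseteq> ring_of_integers (rat_adjoin {P, Q})" "h 1 1 = (\<Sum>y\<leftarrow>xs. y\<^sup>2)"
    using assms(1) unfolding sums_of_squares_def by blast
  have "\<forall>y\<in>set xs. \<exists>a b c d :: int. even (b + d) \<and>
      y = elt (of_int a) (of_int b / 2) (of_int c) (of_int d / 2) 1 1"
    using xs(1) integral_basis by blast
  then obtain a b c d :: "real \<Rightarrow> int" where coords: "\<And>y. y \<in> set xs \<Longrightarrow> even (b y + d y)"
      "\<And>y. y \<in> set xs \<Longrightarrow> y = elt (of_int (a y)) (of_int (b y) / 2) (of_int (c y)) (of_int (d y) / 2) 1 1"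
    by metis
  let ?f = "\<lambda>y. elt (of_int (a y)) (of_int (b y) / 2) (of_int (c y)) (of_int (d y) / 2)"
  have f: "?f y \<in> conjugates \<rat>" for y by (intro elt_conjugates) auto
  have sq: "(\<lambda>e\<^sub>1 e\<^sub>2. (-1) * h e\<^sub>1 e\<^sub>2 + (\<Sum>y\<leftarrow>xs. (?f y e\<^sub>1 e\<^sub>2)\<^sup>2)) \<in> conjugates \<rat>"
    by (intro conjugates_add conjugates_mult conjugates_const conjugates_sum_list conjugates_power
        coeff_ring_Rats assms(2) f) auto
  have "(\<Sum>y\<leftarrow>xs. (?f y 1 1)\<^sup>2) = (\<Sum>y\<leftarrow>xs. y\<^sup>2)"
    using coords(2) by (intro arg_cong[where f = sum_list] map_cong) auto
  then have "(-1) * h 1 1 + (\<Sum>y\<leftarrow>xs. (?f y 1 1)\<^sup>2) = 0" using xs(2) by simp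
  then have "(-1) * h e\<^sub>1 e\<^sub>2 + (\<Sum>y\<leftarrow>xs. (?f y e\<^sub>1 e\<^sub>2)\<^sup>2) = 0" if "e\<^sub>1 \<in> {1, -1}" "e\<^sub>2 \<in> {1, -1}" for e\<^sub>1 e\<^sub>2
    using conjugates_zero[OF sq, of 1 1 e\<^sub>1 e\<^sub>2] that by simp
  then have "(\<Sum>y\<leftarrow>xs. (?f y e\<^sub>1 e\<^sub>2)\<^sup>2) = h e\<^sub>1 e\<^sub>2" if "e\<^sub>1 \<in> {1, -1}" "e\<^sub>2 \<in> {1, -1}" for e\<^sub>1 e\<^sub>2
    using that by fastforce
  with coords(1) show ?thesis by blast
qed

lemma factors_pos: "g > 0" "p' > 0" "q' > 0"
  using mod4 by (auto intro!: Nat.gr0I)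

text \<open>Averaging the conjugate equations over the sign of \<open>Q\<close> removes the cross terms.\<close>

lemma sum_of_squares_first:
  assumes "real m * (of_int w + of_int v * P) \<in> sums_of_squares (ring_of_integers (rat_adjoin {P, Q}))"
  shows "\<exists>(xs :: real list) (a :: real \<Rightarrow> int) (b :: real \<Rightarrow> int) (c :: real \<Rightarrow> int) (d :: real \<Rightarrow> int).
    (\<forall>y\<in>set xs. even (b y + d y)) \<and>
    (\<forall>e\<in>{1, -1}.
      (\<Sum>y\<leftarrow>xs. (of_int (a y) + e * (of_int (b y) / 2) * P)\<^sup>2 + (of_int (c y) * Q + e * (of_int (d y) / 2) * R)\<^sup>2)
        = real m * (of_int w + e * of_int v * P))"
proof -
  let ?h = "elt (real m * of_int w) (real m * of_int v) 0 0"
  have "?h 1 1 = real m * (of_int w + of_int v * P)" unfolding elt_def by (simp add: algebra_simps)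
  moreover have "?h \<in> conjugates \<rat>" by (intro elt_conjugates) auto
  ultimately have "\<exists>(xs :: real list) (a :: real \<Rightarrow> int) (b :: real \<Rightarrow> int) (c :: real \<Rightarrow> int) (d :: real \<Rightarrow> int).
    (\<forall>y\<in>set xs. even (b y + d y)) \<and>
    (\<forall>e\<^sub>1\<in>{1, -1}. \<forall>e\<^sub>2\<in>{1, -1}.
      (\<Sum>y\<leftarrow>xs. (elt (of_int (a y)) (of_int (b y) / 2) (of_int (c y)) (of_int (d y) / 2) e\<^sub>1 e\<^sub>2)\<^sup>2) = ?h e\<^sub>1 e\<^sub>2)"
    using assms by (intro sum_of_squares_conjugates) simp_all
  then obtain xs :: "real list" and a b c d :: "real \<Rightarrow> int" where
    par: "\<forall>y\<in>set xs. even (b y + d y)" and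
    sum: "\<forall>e\<^sub>1\<in>{1, -1}. \<forall>e\<^sub>2\<in>{1, -1}.
      (\<Sum>y\<leftarrow>xs. (elt (of_int (a y)) (of_int (b y) / 2) (of_int (c y)) (of_int (d y) / 2) e\<^sub>1 e\<^sub>2)\<^sup>2) = ?h e\<^sub>1 e\<^sub>2"
    by blast
  have "(\<Sum>y\<leftarrow>xs. (of_int (a y) + e * (of_int (b y) / 2) * P)\<^sup>2 + (of_int (c y) * Q + e * (of_int (d y) / 2) * R)\<^sup>2)
        = real m * (of_int w + e * of_int v * P)" (is "?l = _") if e: "e \<in> {1, -1}" for e
  proof -
    have "2 * ?l = (\<Sum>y\<leftarrow>xs. (elt (of_int (a y)) (of_int (b y) / 2) (of_int (c y)) (of_int (d y) / 2) e 1)\<^sup>2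
      + (elt (of_int (a y)) (of_int (b y) / 2) (of_int (c y)) (of_int (d y) / 2) e (-1))\<^sup>2)"
      unfolding sum_list_const_mult[symmetric]
      by (intro arg_cong[where f = sum_list] map_cong) (auto simp: elt_def power2_eq_square algebra_simps)
    also have "\<dots> = ?h e 1 + ?h e (-1)"
      unfolding sum_list_addf using bspec[OF bspec[OF sum e], of 1] bspec[OF bspec[OF sum e], of "-1"] by simp
    also have "\<dots> = 2 * (real m * (of_int w + e * of_int v * P))"
      unfolding elt_def by (simp add: algebra_simps)
    finally show ?thesis by simp
  qed
  with par show ?thesis by blast
qed

lemma sum_of_squares_second:
  assumes "real m * (of_int w + of_int v * Q) \<in> sums_of_squares (ring_of_integers (rat_adjoin {P, Q}))"
  shows "\<exists>(xs :: real list) (a :: real \<Rightarrow> int) (b :: real \<Rightarrow> int) (c :: real \<Rightarrow> int) (d :: real \<Rightarrow> int).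
    (\<forall>y\<in>set xs. even (b y + d y)) \<and>
    (\<forall>e\<in>{1, -1}.
      (\<Sum>y\<leftarrow>xs. (of_int (a y) + e * of_int (c y) * Q)\<^sup>2 + (of_int (b y) / 2 * P + e * (of_int (d y) / 2) * R)\<^sup>2)
        = real m * (of_int w + e * of_int v * Q))"
proof -
  let ?h = "elt (real m * of_int w) 0 (real m * of_int v) 0"
  have "?h 1 1 = real m * (of_int w + of_int v * Q)" unfolding elt_def by (simp add: algebra_simps)
  moreover have "?h \<in> conjugates \<rat>" by (intro elt_conjugates) auto
  ultimately have "\<exists>(xs :: real list) (a :: real \<Rightarrow> int) (b :: real \<Rightarrow> int) (c :: real \<Rightarrow> int) (d :: real \<Rightarrow> int).
    (\<forall>y\<in>set xs. even (b y + d y)) \<and>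
    (\<forall>e\<^sub>1\<in>{1, -1}. \<forall>e\<^sub>2\<in>{1, -1}.
      (\<Sum>y\<leftarrow>xs. (elt (of_int (a y)) (of_int (b y) / 2) (of_int (c y)) (of_int (d y) / 2) e\<^sub>1 e\<^sub>2)\<^sup>2) = ?h e\<^sub>1 e\<^sub>2)"
    using assms by (intro sum_of_squares_conjugates) simp_all
  then obtain xs :: "real list" and a b c d :: "real \<Rightarrow> int" where
    par: "\<forall>y\<in>set xs. even (b y + d y)" and
    sum: "\<forall>e\<^sub>1\<in>{1, -1}. \<forall>e\<^sub>2\<in>{1, -1}.
      (\<Sum>y\<leftarrow>xs. (elt (of_int (a y)) (of_int (b y) / 2) (of_int (c y)) (of_int (d y) / 2) e\<^sub>1 e\<^sub>2)\<^sup>2) = ?h e\<^sub>1 e\<^sub>2"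
    by blast
  have "(\<Sum>y\<leftarrow>xs. (of_int (a y) + e * of_int (c y) * Q)\<^sup>2 + (of_int (b y) / 2 * P + e * (of_int (d y) / 2) * R)\<^sup>2)
        = real m * (of_int w + e * of_int v * Q)" (is "?l = _") if e: "e \<in> {1, -1}" for e
  proof -
    have "2 * ?l = (\<Sum>y\<leftarrow>xs. (elt (of_int (a y)) (of_int (b y) / 2) (of_int (c y)) (of_int (d y) / 2) 1 e)\<^sup>2
      + (elt (of_int (a y)) (of_int (b y) / 2) (of_int (c y)) (of_int (d y) / 2) (-1) e)\<^sup>2)"
      unfolding sum_list_const_mult[symmetric]
      by (intro arg_cong[where f = sum_list] map_cong) (auto simp: elt_def power2_eq_square algebra_simps)
    also have "\<dots> = ?h 1 e + ?h (-1) e"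
      unfolding sum_list_addf using bspec[OF bspec[OF sum, of 1] e] bspec[OF bspec[OF sum, of "-1"] e] by simp
    also have "\<dots> = 2 * (real m * (of_int w + e * of_int v * Q))"
      unfolding elt_def by (simp add: algebra_simps)
    finally show ?thesis by simp
  qed
  with par show ?thesis by blast
qed

lemma first_not_sum_of_squares:
  assumes m: "m > 0" "q' > 4 * m" and large: "P \<ge> real m / 2 + 4"
  shows "\<exists>w v. quadratic_totally_positive (g * p') w v \<and>
    real m * (of_int w + of_int v * P) \<notin> sums_of_squares (ring_of_integers (rat_adjoin {P, Q}))"
proof -
  have sqrt: "sqrt (real (g * p')) = P" unfolding P_def ..
  obtain w v where wv: "quadratic_totally_positive (g * p') w v"
    "\<not> quadratic_sum_of_squares (g * p') (int m * w) (int m * v)"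
    "\<forall>x y. quadratic_totally_positive (g * p') x y \<longrightarrow> \<not> quadratic_totally_positive (g * p') (w - x) (v - y)"
    using exists_indecomposable_not_sum_of_squares[of "g * p'" m] m(1) large roots_irrational(1)
    unfolding sqrt by blast
  have "real m * (of_int w + of_int v * P) \<notin> sums_of_squares (ring_of_integers (rat_adjoin {P, Q}))"
  proof
    assume "real m * (of_int w + of_int v * P) \<in> sums_of_squares (ring_of_integers (rat_adjoin {P, Q}))"
    then obtain xs :: "real list" and a b c d :: "real \<Rightarrow> int" where
      par: "\<forall>y\<in>set xs. even (b y + d y)" and
      sum: "\<forall>e\<in>{1, -1}.
      (\<Sum>y\<leftarrow>xs. (of_int (a y) + e * (of_int (b y) / 2) * P)\<^sup>2 + (of_int (c y) * Q + e * (of_int (d y) / 2) * R)\<^sup>2)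
        = real m * (of_int w + e * of_int v * P)"
      using sum_of_squares_first by blast
    define x z where "x = (\<lambda>y. 4 * int g * (c y)\<^sup>2 + int p' * (d y)\<^sup>2)" and "z = (\<lambda>y. 4 * c y * d y)"
    have V: "(of_int (c y) * Q + e * (of_int (d y) / 2) * R)\<^sup>2 = real q' / 4 * (of_int (x y) + e * of_int (z y) * P)"
      if e: "e \<in> {1, -1}" for y e
    proof -
      have "(of_int (c y) * Q + e * (of_int (d y) / 2) * R)\<^sup>2 =
        (of_int (c y))\<^sup>2 * (Q * Q) + (e * e) * (of_int (d y))\<^sup>2 / 4 * (R * R) + e * of_int (c y) * of_int (d y) * (Q * R)"
        by (simp add: power2_eq_square algebra_simps)
      moreover have "e * e = 1" using e by auto
      ultimately show ?thesis unfolding mult_roots x_def z_def by (simp add: algebra_simps)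
    qed
    show False
    proof (rule indecomposable_no_mixed_representation[OF _ m(1) wv(2,3),
          where T = "real q' / 4" and a = "\<lambda>y. of_int (a y)" and b = "\<lambda>y. of_int (b y) / 2" and x = x and z = z and xs = xs])
      show "sqrt (real (g * p')) \<notin> \<rat>" unfolding sqrt by (rule roots_irrational)
      show "real m < real q' / 4" using m(2) by linarith
      show "(\<Sum>y\<leftarrow>xs. (of_int (a y) + e * (of_int (b y) / 2) * sqrt (real (g * p')))\<^sup>2 +
          real q' / 4 * (of_int (x y) + e * of_int (z y) * sqrt (real (g * p'))))
        = real m * (of_int w + e * of_int v * sqrt (real (g * p')))" if "e \<in> {1, -1}" for e
        unfolding sqrt V[OF that, symmetric] by (rule bspec[OF sum that])
      fix y assume y: "y \<in> set xs"
      show "quadratic_totally_positive (g * p') (x y) (z y) \<or>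
        x y = 0 \<and> z y = 0 \<and> real_of_int (a y) \<in> \<int> \<and> real_of_int (b y) / 2 \<in> \<int>"
      proof (cases "c y = 0 \<and> d y = 0")
        case True
        then obtain k where "b y = 2 * k" using bspec[OF par y] by auto
        then show ?thesis using True unfolding x_def z_def by simp
      next
        case False
        have "of_int (x y) + e * of_int (z y) * P > 0" if e: "e \<in> {1, -1}" for e
        proof -
          have "of_int (c y) * Q + e * (of_int (d y) / 2) * R \<noteq> 0"
          proof
            assume "of_int (c y) * Q + e * (of_int (d y) / 2) * R = 0"
            then have "elt 0 0 (of_int (c y)) (e * (of_int (d y) / 2)) 1 1 = 0" unfolding elt_def by simp
            moreover have "e * (of_int (d y) / 2) \<in> \<rat>" using e by auto
            ultimately have "real_of_int (c y) = 0 \<and> e * (of_int (d y) / 2) = 0"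
              using elt_independent[of 0 0 "of_int (c y)" "e * (of_int (d y) / 2)"] by auto
            then show False using False e by auto
          qed
          then have "0 < (of_int (c y) * Q + e * (of_int (d y) / 2) * R)\<^sup>2" by simp
          then have "0 < real q' / 4 * (of_int (x y) + e * of_int (z y) * P)" unfolding V[OF e] .
          then show ?thesis by (rule zero_less_mult_pos) (use factors_pos in simp)
        qed
        from this[of 1] this[of "-1"] show ?thesis
          unfolding quadratic_totally_positive_def sqrt by simp
      qed
    qed
  qed
  then show ?thesis using wv(1) by blast
qed

lemma second_not_sum_of_squares:
  assumes m: "m > 0" "p' > 2 * m" and large: "Q \<ge> real m / 2 + 4"
  shows "\<exists>w v. quadratic_totally_positive (g * q') w v \<and>
    real m * (of_int w + of_int v * Q) \<notin> sums_of_squares (ring_of_integers (rat_adjoin {P, Q}))"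
proof -
  have sqrt: "sqrt (real (g * q')) = Q" unfolding Q_def ..
  obtain w v where wv: "quadratic_totally_positive (g * q') w v"
    "\<not> quadratic_sum_of_squares (g * q') (int m * w) (int m * v)"
    "\<forall>x y. quadratic_totally_positive (g * q') x y \<longrightarrow> \<not> quadratic_totally_positive (g * q') (w - x) (v - y)"
    using exists_indecomposable_not_sum_of_squares[of "g * q'" m] m(1) large roots_irrational(2)
    unfolding sqrt by blast
  have "real m * (of_int w + of_int v * Q) \<notin> sums_of_squares (ring_of_integers (rat_adjoin {P, Q}))"
  proof
    assume "real m * (of_int w + of_int v * Q) \<in> sums_of_squares (ring_of_integers (rat_adjoin {P, Q}))"
    then obtain xs :: "real list" and a b c d :: "real \<Rightarrow> int" where
      par: "\<forall>y\<in>set xs. even (b y + d y)" and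
      sum: "\<forall>e\<in>{1, -1}.
      (\<Sum>y\<leftarrow>xs. (of_int (a y) + e * of_int (c y) * Q)\<^sup>2 + (of_int (b y) / 2 * P + e * (of_int (d y) / 2) * R)\<^sup>2)
        = real m * (of_int w + e * of_int v * Q)"
      using sum_of_squares_second by blast
    define x z where "x = (\<lambda>y. (int g * (b y)\<^sup>2 + int q' * (d y)\<^sup>2) div 2)" and "z = (\<lambda>y. b y * d y)"
    have x: "2 * real_of_int (x y) = real g * (of_int (b y))\<^sup>2 + real q' * (of_int (d y))\<^sup>2" if "y \<in> set xs" for y
    proof -
      have "even (int g * (b y)\<^sup>2 + int q' * (d y)\<^sup>2)" using bspec[OF par that] odd_factors by simp
      then have "2 * x y = int g * (b y)\<^sup>2 + int q' * (d y)\<^sup>2" unfolding x_def by simp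
      then have "real_of_int (2 * x y) = of_int (int g * (b y)\<^sup>2 + int q' * (d y)\<^sup>2)" by simp
      then show ?thesis by simp
    qed
    have V: "(of_int (b y) / 2 * P + e * (of_int (d y) / 2) * R)\<^sup>2 = real p' / 2 * (of_int (x y) + e * of_int (z y) * Q)"
      if y: "y \<in> set xs" and e: "e \<in> {1, -1}" for y e
    proof -
      have "(of_int (b y) / 2 * P + e * (of_int (d y) / 2) * R)\<^sup>2 =
        (of_int (b y))\<^sup>2 / 4 * (P * P) + (e * e) * (of_int (d y))\<^sup>2 / 4 * (R * R) + e * of_int (b y) * of_int (d y) / 2 * (P * R)"
        by (simp add: power2_eq_square algebra_simps)
      also have "\<dots> = real p' / 4 * (real g * (of_int (b y))\<^sup>2 + real q' * (of_int (d y))\<^sup>2)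
          + e * of_int (b y) * of_int (d y) / 2 * (real p' * Q)"
        using e unfolding mult_roots by (auto simp: algebra_simps)
      also have "\<dots> = real p' / 2 * (of_int (x y) + e * of_int (z y) * Q)"
        unfolding x[OF y, symmetric] z_def by (simp add: algebra_simps)
      finally show ?thesis .
    qed
    show False
    proof (rule indecomposable_no_mixed_representation[OF _ m(1) wv(2,3),
          where T = "real p' / 2" and a = "\<lambda>y. of_int (a y)" and b = "\<lambda>y. of_int (c y)" and x = x and z = z and xs = xs])
      show "sqrt (real (g * q')) \<notin> \<rat>" unfolding sqrt by (rule roots_irrational)
      show "real m < real p' / 2" using m(2) by linarith
      show "(\<Sum>y\<leftarrow>xs. (of_int (a y) + e * of_int (c y) * sqrt (real (g * q')))\<^sup>2 +
          real p' / 2 * (of_int (x y) + e * of_int (z y) * sqrt (real (g * q'))))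
        = real m * (of_int w + e * of_int v * sqrt (real (g * q')))" if "e \<in> {1, -1}" for e
      proof -
        have "(\<Sum>y\<leftarrow>xs. (of_int (a y) + e * of_int (c y) * Q)\<^sup>2 + real p' / 2 * (of_int (x y) + e * of_int (z y) * Q))
          = (\<Sum>y\<leftarrow>xs. (of_int (a y) + e * of_int (c y) * Q)\<^sup>2 + (of_int (b y) / 2 * P + e * (of_int (d y) / 2) * R)\<^sup>2)"
          using V[OF _ that] by (intro arg_cong[where f = sum_list] map_cong) auto
        then show ?thesis unfolding sqrt using bspec[OF sum that] by simp
      qed
      fix y assume y: "y \<in> set xs"
      show "quadratic_totally_positive (g * q') (x y) (z y) \<or>
        x y = 0 \<and> z y = 0 \<and> real_of_int (a y) \<in> \<int> \<and> real_of_int (c y) \<in> \<int>"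
      proof (cases "b y = 0 \<and> d y = 0")
        case True
        then show ?thesis unfolding x_def z_def by simp
      next
        case False
        have "of_int (x y) + e * of_int (z y) * Q > 0" if e: "e \<in> {1, -1}" for e
        proof -
          have "of_int (b y) / 2 * P + e * (of_int (d y) / 2) * R \<noteq> 0"
          proof
            assume "of_int (b y) / 2 * P + e * (of_int (d y) / 2) * R = 0"
            then have "elt 0 (of_int (b y) / 2) 0 (e * (of_int (d y) / 2)) 1 1 = 0" unfolding elt_def by simp
            moreover have "e * (of_int (d y) / 2) \<in> \<rat>" using e by auto
            ultimately have "real_of_int (b y) / 2 = 0 \<and> e * (of_int (d y) / 2) = 0"
              using elt_independent[of 0 "of_int (b y) / 2" 0 "e * (of_int (d y) / 2)"] by auto
            then show False using False e by auto
          qed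
          then have "0 < (of_int (b y) / 2 * P + e * (of_int (d y) / 2) * R)\<^sup>2" by simp
          then have "0 < real p' / 2 * (of_int (x y) + e * of_int (z y) * Q)" unfolding V[OF y e] .
          then show ?thesis by (rule zero_less_mult_pos) (use factors_pos in simp)
        qed
        from this[of 1] this[of "-1"] show ?thesis
          unfolding quadratic_totally_positive_def sqrt by simp
      qed
    qed
  qed
  then show ?thesis using wv(1) by blast
qed

lemma second_not_sum_of_squares_small:
  assumes m: "m > 0" and large: "Q \<ge> real m + 8" and r: "4 * real m * of_int \<lceil>Q\<rceil> \<le> real p' * real q'"
  shows "\<exists>w v. quadratic_totally_positive (g * q') w v \<and>
    real m * (of_int w + of_int v * Q) \<notin> sums_of_squares (ring_of_integers (rat_adjoin {P, Q}))"
proof -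
  have sqrt: "sqrt (real (g * q')) = Q" unfolding Q_def ..
  define u where "u = \<lceil>Q\<rceil>"
  have "Q \<noteq> of_int u" using roots_irrational(2) by auto
  then have u: "Q < of_int u" "of_int u < Q + 1" unfolding u_def by linarith+
  have "quadratic_totally_positive (g * q') u 1"
    unfolding quadratic_totally_positive_def sqrt using u large m by simp
  moreover have "real m * (of_int u + of_int 1 * Q) \<notin> sums_of_squares (ring_of_integers (rat_adjoin {P, Q}))"
  proof
    assume "real m * (of_int u + of_int 1 * Q) \<in> sums_of_squares (ring_of_integers (rat_adjoin {P, Q}))"
    then obtain xs :: "real list" and a b c d :: "real \<Rightarrow> int" where
      sum: "\<forall>e\<in>{1, -1}.
      (\<Sum>y\<leftarrow>xs. (of_int (a y) + e * of_int (c y) * Q)\<^sup>2 + (of_int (b y) / 2 * P + e * (of_int (d y) / 2) * R)\<^sup>2)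
        = real m * (of_int u + e * of_int 1 * Q)"
      using sum_of_squares_second[of m u 1] by blast
    let ?S = "\<lambda>e y. (of_int (a y) + e * of_int (c y) * Q)\<^sup>2 + (of_int (b y) / 2 * P + e * (of_int (d y) / 2) * R)\<^sup>2"
    define M where "M = (\<lambda>y. (real_of_int (a y))\<^sup>2 + real g * real q' * (of_int (c y))\<^sup>2
       + real g * real p' / 4 * (of_int (b y))\<^sup>2 + real p' * real q' / 4 * (of_int (d y))\<^sup>2)"
    define L where "L = (\<lambda>y. 4 * of_int (a y) * of_int (c y) + real p' * of_int (b y) * of_int (d y))"
    have S_sum: "?S 1 y + ?S (-1) y = 2 * M y" for y
    proof -
      have "?S 1 y + ?S (-1) y = 2 * ((real_of_int (a y))\<^sup>2 + (of_int (c y))\<^sup>2 * (Q * Q)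
         + (of_int (b y))\<^sup>2 / 4 * (P * P) + (of_int (d y))\<^sup>2 / 4 * (R * R))"
        by (simp add: power2_eq_square algebra_simps)
      then show ?thesis unfolding mult_roots M_def by (simp add: algebra_simps)
    qed
    have S_diff: "?S 1 y - ?S (-1) y = L y * Q" for y
    proof -
      have "?S 1 y - ?S (-1) y = 4 * of_int (a y) * of_int (c y) * Q + of_int (b y) * of_int (d y) * (P * R)"
        by (simp add: power2_eq_square algebra_simps)
      then show ?thesis unfolding mult_roots L_def by (simp add: algebra_simps)
    qed
    have "2 * (\<Sum>y\<leftarrow>xs. M y) = (\<Sum>y\<leftarrow>xs. ?S 1 y) + (\<Sum>y\<leftarrow>xs. ?S (-1) y)"
      unfolding sum_list_const_mult[symmetric] sum_list_addf[symmetric] S_sum ..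
    then have M_total: "(\<Sum>y\<leftarrow>xs. M y) = real m * of_int u"
      using bspec[OF sum, of 1] bspec[OF sum, of "-1"] by (simp add: algebra_simps)
    have L_total: "(\<Sum>y\<leftarrow>xs. L y * Q) = 2 * real m * Q"
      unfolding S_diff[symmetric] sum_list_subtractf using bspec[OF sum, of 1] bspec[OF sum, of "-1"] by (simp add: algebra_simps)
    have "L y = 0" if y: "y \<in> set xs" for y
    proof -
      have M_le: "M y \<le> real m * of_int u"
        unfolding M_total[symmetric] by (intro sum_list_ge_member y) (simp add: M_def)
      have "c y = 0"
      proof (rule ccontr)
        assume "c y \<noteq> 0"
        then have "(c y)\<^sup>2 \<ge> 1" by (simp add: int_one_le_iff_zero_less)
        then have "(real_of_int (c y))\<^sup>2 \<ge> 1" by (metis of_int_1_le_iff of_int_power)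
        then have "Q * Q * 1 \<le> Q * Q * (of_int (c y))\<^sup>2" by (intro mult_left_mono) auto
        also have "\<dots> \<le> M y" unfolding M_def mult_roots by simp
        also have "\<dots> \<le> real m * of_int u" by (rule M_le)
        also have "\<dots> \<le> (Q - 8) * (Q + 1)" using large u m by (intro mult_mono) auto
        also have "\<dots> < Q * Q" using large by (simp add: algebra_simps)
        finally show False by simp
      qed
      moreover have "d y = 0"
      proof (rule ccontr)
        assume "d y \<noteq> 0"
        then have "(d y)\<^sup>2 \<ge> 1" by (simp add: int_one_le_iff_zero_less)
        then have "(real_of_int (d y))\<^sup>2 \<ge> 1" by (metis of_int_1_le_iff of_int_power)
        then have "real p' * real q' / 4 * 1 \<le> real p' * real q' / 4 * (of_int (d y))\<^sup>2"
          by (intro mult_left_mono) auto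
        also have "\<dots> \<le> M y" unfolding M_def by simp
        also have "\<dots> \<le> real m * of_int u" by (rule M_le)
        finally have "real p' * real q' = 4 * real m * of_int u" using r unfolding u_def by linarith
        then have "real_of_int (int (p' * q')) = of_int (4 * (int m * u))" by simp
        then have "int (p' * q') = 4 * (int m * u)" using of_int_eq_iff by blast
        then show False using mod4(3) by presburger
      qed
      ultimately show ?thesis unfolding L_def by simp
    qed
    then have "(\<Sum>y\<leftarrow>xs. L y * Q) = 0" by (induction xs) auto
    then show False using L_total m large by simp
  qed
  ultimately show ?thesis by blast
qed

end

lemma image_not_subset_sums_of_squares:
  assumes "\<exists>w v. quadratic_totally_positive D w v \<and>
    real m * (of_int w + of_int v * sqrt (real D)) \<notin> S"
  shows "\<not> (\<lambda>\<alpha>. real m * \<alpha>) ` totally_positive_integers (rat_adjoin {sqrt (real D)}) \<subseteq> S"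
  using assms totally_positive_integers_quadratic by blast

theorem theorem1:
  fixes p q r m :: nat and K F\<^sub>1 F\<^sub>2 :: "real set"
  assumes "p \<ge> 2" and "q \<ge> 2"
    and "squarefree p" and "squarefree q"
    and "p mod 4 = 2" and "q mod 4 = 3"
    and "r = p * q div (gcd p q)\<^sup>2"
    and "p < q" and "q < r"
    and "K = rat_adjoin {sqrt (real p), sqrt (real q)}"
    and "F\<^sub>1 = rat_adjoin {sqrt (real p)}"
    and "F\<^sub>2 = rat_adjoin {sqrt (real q)}"
    and "m > 0"
    and "\<exists>\<kappa>::nat. \<kappa> > 0 \<and>
      real m \<le> Min {real r / (4 * real_of_int \<lceil>real \<kappa> * sqrt (real r)\<rceil>), real p, real q}"
    and "real p \<ge> (real m / 2 + 4)\<^sup>2"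
    and "real q \<ge> (real m / 2 + 4)\<^sup>2"
  shows "\<not> (\<lambda>\<alpha>. real m * \<alpha>) ` totally_positive_integers F\<^sub>1
             \<subseteq> sums_of_squares (ring_of_integers K) \<and>
         \<not> (\<lambda>\<alpha>. real m * \<alpha>) ` totally_positive_integers F\<^sub>2
             \<subseteq> sums_of_squares (ring_of_integers K)"
proof -
  define g p' q' where "g = gcd p q" and "p' = p div g" and "q' = q div g"
  have p: "p = g * p'" and q: "q = g * q'" unfolding g_def p'_def q'_def by simp_all
  have "g > 0" unfolding g_def using assms(1) by simp
  have coprime: "coprime p' q'"
    unfolding p'_def q'_def g_def using assms(1) by (intro div_gcd_coprime) auto
  have "p * q = p' * q' * g\<^sup>2" unfolding p q by (simp add: power2_eq_square mult_ac)
  then have r: "r = p' * q'" unfolding assms(7) g_def[symmetric] using \<open>g > 0\<close> by simp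
  interpret biquadratic_field g p' q'
  proof
    show "squarefree (g * p')" "squarefree (g * q')" "g * p' mod 4 = 2" "g * q' mod 4 = 3"
      using assms(3-6) unfolding p q by auto
    then have "squarefree p'" "squarefree q'" using squarefree_multD by blast+
    then show "squarefree (p' * q')" using coprime by (intro squarefree_mult_coprime)
    have "odd (g * q')" using \<open>g * q' mod 4 = 3\<close> by presburger
    then have "odd g" by simp
    then obtain j where "g = 2 * j + 1" by (elim oddE)
    then have "g\<^sup>2 = 4 * (j\<^sup>2 + j) + 1" by (simp add: power2_eq_square)
    then have "p' * q' * g\<^sup>2 = 4 * ((j\<^sup>2 + j) * (p' * q')) + p' * q'" by (simp add: algebra_simps)
    then have "p' * q' mod 4 = (p * q) mod 4" using \<open>p * q = p' * q' * g\<^sup>2\<close> by simp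
    also have "\<dots> = (p mod 4) * (q mod 4) mod 4" by (simp add: mod_mult_eq)
    finally show "p' * q' mod 4 = 2" using assms(5,6) by simp
  qed
  have PQR: "P = sqrt (real p)" "Q = sqrt (real q)" "R = sqrt (real r)"
    unfolding P_def Q_def R_def p q r by simp_all
  have K: "K = rat_adjoin {P, Q}" using assms(10) unfolding PQR .
  obtain \<kappa> :: nat where \<kappa>: "\<kappa> > 0" "real m \<le> real r / (4 * real_of_int \<lceil>real \<kappa> * R\<rceil>)"
    using assms(14) unfolding PQR by auto
  have R0: "R > 0" unfolding PQR using assms(2,9) by simp
  have "1 * R \<le> real \<kappa> * R" using \<kappa>(1) R0 by (intro mult_right_mono) auto
  then have ceil: "\<lceil>R\<rceil> \<le> \<lceil>real \<kappa> * R\<rceil>" by (intro ceiling_mono) simp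
  have "\<lceil>R\<rceil> > 0" using R0 by simp
  then have "real_of_int \<lceil>real \<kappa> * R\<rceil> > 0" using ceil by linarith
  then have "4 * real m * of_int \<lceil>real \<kappa> * R\<rceil> \<le> real r"
    using \<kappa>(2) by (simp add: field_simps)
  moreover have "4 * real m * of_int \<lceil>R\<rceil> \<le> 4 * real m * of_int \<lceil>real \<kappa> * R\<rceil>"
    using ceil by (intro mult_left_mono) auto
  ultimately have size: "4 * real m * of_int \<lceil>R\<rceil> \<le> real r" by linarith
  have RR: "R * R = real r" unfolding PQR by simp
  have "4 * real m * R \<le> 4 * real m * of_int \<lceil>R\<rceil>" by (intro mult_left_mono) auto
  then have "4 * real m * R \<le> R * R" using size RR by linarith
  then have R: "4 * real m \<le> R" using R0 by simp
  have "p' < q'" using assms(8) \<open>g > 0\<close> unfolding p q by simp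
  have "4 * m < q'"
  proof -
    have "(4 * real m)\<^sup>2 \<le> R\<^sup>2" using R by (intro power_mono) auto
    then have "real ((4 * m)\<^sup>2) \<le> real (p' * q')" using RR r by (simp add: power2_eq_square)
    then have "(4 * m)\<^sup>2 \<le> p' * q'" using of_nat_le_iff by blast
    also have "\<dots> < q'\<^sup>2" using \<open>p' < q'\<close> unfolding power2_eq_square by (intro mult_strict_right_mono) auto
    finally show ?thesis by (rule power_less_imp_less_base) simp
  qed
  have large: "P \<ge> real m / 2 + 4" "Q \<ge> real m / 2 + 4"
    unfolding PQR using assms(15,16) by (auto intro: real_le_rsqrt)
  have first: "\<exists>w v. quadratic_totally_positive p w v \<and>
      real m * (of_int w + of_int v * sqrt (real p)) \<notin> sums_of_squares (ring_of_integers K)"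
    using first_not_sum_of_squares[OF assms(13) \<open>4 * m < q'\<close> large(1)]
    unfolding K p[symmetric] PQR(1)[symmetric] .
  have second: "\<exists>w v. quadratic_totally_positive q w v \<and>
      real m * (of_int w + of_int v * sqrt (real q)) \<notin> sums_of_squares (ring_of_integers K)"
    unfolding K q PQR(2)[symmetric] Q_def[symmetric]
  proof (cases "p' > 2 * m")
    case True
    then show "\<exists>w v. quadratic_totally_positive (g * q') w v \<and>
      real m * (of_int w + of_int v * Q) \<notin> sums_of_squares (ring_of_integers (rat_adjoin {P, Q}))"
      using second_not_sum_of_squares[OF assms(13) _ large(2)] by blast
  next
    case False
    have Q0: "Q > 0" unfolding PQR using assms(2) by simp
    have "(real m / 2 + 4) * (4 * real m) \<le> P * R" using large(1) R R0 by (intro mult_mono) auto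
    also have "\<dots> = real p' * Q" by (rule mult_roots)
    also have "\<dots> \<le> (2 * real m) * Q" using False Q0 by (intro mult_right_mono) auto
    finally have "(2 * real m) * (real m + 8) \<le> (2 * real m) * Q" by (simp add: algebra_simps)
    then have "Q \<ge> real m + 8" using assms(13) by simp
    moreover have "4 * real m * of_int \<lceil>Q\<rceil> \<le> real p' * real q'"
    proof -
      have "Q \<le> R" unfolding PQR using assms(9) by simp
      then have "4 * real m * of_int \<lceil>Q\<rceil> \<le> 4 * real m * of_int \<lceil>R\<rceil>"
        by (intro mult_left_mono) (auto intro: ceiling_mono)
      then show ?thesis using size r by simp
    qed
    ultimately show "\<exists>w v. quadratic_totally_positive (g * q') w v \<and>
      real m * (of_int w + of_int v * Q) \<notin> sums_of_squares (ring_of_integers (rat_adjoin {P, Q}))"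
      using second_not_sum_of_squares_small assms(13) by blast
  qed
  show ?thesis
    unfolding assms(11,12)
    using image_not_subset_sums_of_squares[OF first] image_not_subset_sums_of_squares[OF second] by blast
qed

end
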